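(* Let $\mathcal{M}$ be a Markov automaton with underlying MDP $\mathcal{M}_u$, let $\mathbb{O}=(O_1,\dots,O_d)$ be objectives each of which is either an untimed reachability objective $\mathbb{P}(\Diamond G)$ or an expected reward objective $\mathbb{E}(\rho_j,G)$, let $\rhd\in\{<,\le,>,\ge\}^d$ and $p\in\mathbb{R}^d$. Then $\mathrm{achieve}^{\mathcal{M}}(\mathbb{O}\rhd p)$ holds if and only if $\mathrm{achieve}^{\mathcal{M}_u}(\mathbb{O}\rhd p)$ holds, where on $\mathcal{M}_u$ the objective $\mathbb{E}(\rho_j,G)$ is evaluated w.r.t. the reward function $\rho^u_j$.
   Context: A Markov automaton (MA) is a tuple $\mathcal{M}=(S,\mathit{Act},\to,s_0,\{\rho_1,\dots,\rho_\ell\})$ with $S$ a finite set of states, $s_0$ the initial state, $\mathit{Act}$ a finite action set with distinguished $\bot$, transitions $\to\subseteq S\times(\mathit{Act}\,\dot\cup\,\mathbb{R}_{>0})\times\mathrm{Dist}(S)$ with at most one rate-labelled (Markovian) transition per state, reward functions $\rho_i\colon S\,\dot\cup\,(S\times\mathit{Act})\to\mathbb{R}_{\ge0}$ (state rewards $\rho_i(s)$, action rewards $\rho_i(s,\alpha)$). Standing assumptions: action-determinism, every state has an outgoing transition, maximal progress ($S=PS\,\dot\cup\,MS$), non-Zenoness. $E(s)$ is the exit rate of $s\in MS$, $P(s,\alpha,s')$ the transition probabilities ($\alpha=\bot$ for Markovian transitions). Paths $s_0\xrightarrow{\kappa_0}s_1\cdots$: $\kappa_i\in\mathit{Act}$ at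 $PS$ (with $t(\kappa_i)=0$, $\alpha(\kappa_i)=\kappa_i$), $\kappa_i\in\mathbb{R}_{\ge0}$ sojourn time at $MS$ (with $t(\kappa_i)=\kappa_i$, $\alpha(\kappa_i)=\bot$). Generic schedulers $\sigma$ map finite paths measurably to distributions over enabled actions; they induce $\Pr^{\mathcal{M}}_\sigma$ (probabilistic steps by $\sigma$ and $P$; sojourn at $s\in MS$ with density $E(s)e^{-E(s)t}$, successor by $P(s,\bot,\cdot)$). Reward of a finite path: $\sum_{i<|\pi|}\rho(s_i)t(\kappa_i)+\rho(s_i,\alpha(\kappa_i))$; reward up to $G$ of an infinite path: reward of the prefix ending at the first $G$-state, or limit of prefix rewards if $G$ is never reached; $\mathbb{E}(\rho,G)$ has value its expectation. $\mathbb{P}(\Diamond G)$ is the probability to eventually visit $G$. The underlying MDP is $\mathcal{M}_u=(S,\mathit{Act},P,s_0,\{\rho^u_i\})$ with action rewards $\rho^u_i(s,\alpha)=\rho_i(s,\alpha)$ if $s\in PS$, $\rho^u_i(s,\bot)=\rho_i(s,\bot)+\rho_i(s)/E(s)$ if $s\in MS$, and $0$ otherwise; MDP schedulers are history-dependent randomized, the probability of a finite path is the product of scheduler and transition probabilities, and path rewards are sums of action rewards. $\mathrm{achieve}^{\mathcal{N}}(\mathbb{O}\rhd p)$ holds iff some scheduler of $\mathcal{N}$ makes the value of each $O_i$ satisfy $\rhd_ip_i$. *)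

theory Defs
  imports "HOL-Probability.Probability"
begin

text \<open>
  The finite sets of states and actions are the types \<open>'s\<close> and \<open>'a\<close> of class \<open>finite\<close>.
  The initial state \<open>s\<^sub>0\<close> being fixed, the finite path
  \<open>s\<^sub>0 \<rightarrow>\<kappa>\<^sub>0 s\<^sub>1 \<rightarrow>\<kappa>\<^sub>1 \<dots> s\<^sub>n\<close> is the list \<open>[(\<kappa>\<^sub>0, s\<^sub>1), \<dots>, (\<kappa>\<^sub>n\<^sub>-\<^sub>1, s\<^sub>n)]\<close>,
  and an infinite path is the function \<open>\<omega>\<close> with \<open>\<omega> i = (\<kappa>\<^sub>i, s\<^sub>i\<^sub>+\<^sub>1)\<close>. This is used both for Markov
  automata and for MDPs, with different types of labels.
\<close>

definition last_state :: "'s \<Rightarrow> ('l \<times> 's) list \<Rightarrow> 's" where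
  "last_state s0 \<pi> = (if \<pi> = [] then s0 else snd (last \<pi>))"

fun is_path :: "('s \<Rightarrow> 'l \<Rightarrow> 's \<Rightarrow> bool) \<Rightarrow> 's \<Rightarrow> ('l \<times> 's) list \<Rightarrow> bool" where
  "is_path R s [] \<longleftrightarrow> True"
| "is_path R s ((\<kappa>, s') # \<pi>) \<longleftrightarrow> R s \<kappa> s' \<and> is_path R s' \<pi>"

definition state_at :: "'s \<Rightarrow> (nat \<Rightarrow> 'l \<times> 's) \<Rightarrow> nat \<Rightarrow> 's" where
  "state_at s0 \<omega> n = (case n of 0 \<Rightarrow> s0 | Suc m \<Rightarrow> snd (\<omega> m))"

definition prefix_path :: "(nat \<Rightarrow> 'l \<times> 's) \<Rightarrow> nat \<Rightarrow> ('l \<times> 's) list" where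
  "prefix_path \<omega> n = map \<omega> [0..<n]"

definition prefix_reward :: "'s \<Rightarrow> ('s \<Rightarrow> 'l \<Rightarrow> real) \<Rightarrow> (nat \<Rightarrow> 'l \<times> 's) \<Rightarrow> nat \<Rightarrow> real" where
  "prefix_reward s0 c \<omega> n = (\<Sum>i<n. c (state_at s0 \<omega> i) (fst (\<omega> i)))"

definition reward_upto ::
  "'s \<Rightarrow> ('s \<Rightarrow> 'l \<Rightarrow> real) \<Rightarrow> 's set \<Rightarrow> (nat \<Rightarrow> 'l \<times> 's) \<Rightarrow> ennreal" where
  "reward_upto s0 c G \<omega> =
     (if \<exists>n. state_at s0 \<omega> n \<in> G
      then ennreal (prefix_reward s0 c \<omega> (LEAST n. state_at s0 \<omega> n \<in> G))
      else lim (\<lambda>n. ennreal (prefix_reward s0 c \<omega> n)))"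

text \<open>
  The Ionescu-Tulcea measure on infinite paths, where \<open>K \<pi>\<close> is the distribution of the next
  label and state after the finite path \<open>\<pi>\<close>, and \<open>N\<close> carries the \<open>\<sigma>\<close>-algebra on label/state pairs.
\<close>

definition path_measure ::
  "(('l \<times> 's) list \<Rightarrow> ('l \<times> 's) measure) \<Rightarrow> ('l \<times> 's) measure \<Rightarrow> (nat \<Rightarrow> 'l \<times> 's) measure" where
  "path_measure K N =
     projective_family.lim UNIV (Ionescu_Tulcea.CI (\<lambda>n \<omega>. K (prefix_path \<omega> n)) (\<lambda>_. N)) (\<lambda>_. N)"


text \<open>The \<open>\<ell>\<close> reward functions of a model form a list, so \<open>j < \<ell>\<close> stands for \<open>\<rho>\<^sub>j\<^sub>+\<^sub>1\<close>.\<close>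

datatype 's objective = Reach "'s set" | Exp_Reward nat "'s set"

fun objective_ok :: "nat \<Rightarrow> 's objective \<Rightarrow> bool" where
  "objective_ok l (Reach G) \<longleftrightarrow> True"
| "objective_ok l (Exp_Reward j G) \<longleftrightarrow> j < l"

fun objective_value ::
  "(nat \<Rightarrow> 'l \<times> 's) measure \<Rightarrow> 's \<Rightarrow> (nat \<Rightarrow> 's \<Rightarrow> 'l \<Rightarrow> real) \<Rightarrow> 's objective \<Rightarrow> ereal" where
  "objective_value Pr s0 c (Reach G) =
     ereal (measure Pr {\<omega> \<in> space Pr. \<exists>n. state_at s0 \<omega> n \<in> G})"
| "objective_value Pr s0 c (Exp_Reward j G) =
     enn2ereal (\<integral>\<^sup>+ \<omega>. reward_upto s0 (c j) G \<omega> \<partial>Pr)"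

definition satisfies_all ::
  "('s objective \<Rightarrow> ereal) \<Rightarrow> 's objective list \<Rightarrow> (ereal \<Rightarrow> ereal \<Rightarrow> bool) list \<Rightarrow> real list \<Rightarrow> bool" where
  "satisfies_all val Os rels p \<longleftrightarrow>
     (\<forall>i<length Os. (rels ! i) (val (Os ! i)) (ereal (p ! i)))"


text \<open>Labels of transitions are \<open>Inl \<alpha>\<close> for actions and \<open>Inr r\<close> for rates.\<close>

record ('s, 'a) ma =
  ma_trans :: "('s \<times> ('a + real) \<times> 's pmf) set"
  ma_bot :: 'a
  ma_init :: 's
  ma_rewards :: "('s + 's \<times> 'a \<Rightarrow> real) list"

definition PS :: "('s, 'a) ma \<Rightarrow> 's set" where
  "PS M = {s. \<exists>\<alpha> \<mu>. (s, Inl \<alpha>, \<mu>) \<in> ma_trans M}"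

definition MS :: "('s, 'a) ma \<Rightarrow> 's set" where
  "MS M = {s. \<exists>r \<mu>. (s, Inr r, \<mu>) \<in> ma_trans M}"

definition exit_rate :: "('s, 'a) ma \<Rightarrow> 's \<Rightarrow> real" where
  "exit_rate M s = (THE r. \<exists>\<mu>. (s, Inr r, \<mu>) \<in> ma_trans M)"

definition succ_dists :: "('s, 'a) ma \<Rightarrow> 's \<Rightarrow> 'a \<Rightarrow> 's pmf set" where
  "succ_dists M s \<alpha> =
     {\<mu>. (s, Inl \<alpha>, \<mu>) \<in> ma_trans M \<or> (\<alpha> = ma_bot M \<and> (\<exists>r. (s, Inr r, \<mu>) \<in> ma_trans M))}"

definition ma_prob :: "('s, 'a) ma \<Rightarrow> 's \<Rightarrow> 'a \<Rightarrow> 's \<Rightarrow> real" where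
  "ma_prob M s \<alpha> s' =
     (if succ_dists M s \<alpha> = {} then 0 else pmf (THE \<mu>. \<mu> \<in> succ_dists M s \<alpha>) s')"

definition enabled :: "('s \<Rightarrow> 'a \<Rightarrow> 's \<Rightarrow> real) \<Rightarrow> 's \<Rightarrow> 'a set" where
  "enabled P s = {\<alpha>. \<exists>s'. P s \<alpha> s' > 0}"

definition markov_automaton :: "('s::finite, 'a::finite) ma \<Rightarrow> bool" where
  "markov_automaton M \<longleftrightarrow>
     (\<forall>s r \<mu>. (s, Inr r, \<mu>) \<in> ma_trans M \<longrightarrow> r > 0) \<and>
     (\<forall>s r \<mu> r' \<mu>'. (s, Inr r, \<mu>) \<in> ma_trans M \<and> (s, Inr r', \<mu>') \<in> ma_trans M
        \<longrightarrow> r = r' \<and> \<mu> = \<mu>') \<and>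
     (\<forall>\<rho>\<in>set (ma_rewards M). \<forall>x. \<rho> x \<ge> 0)"

definition action_deterministic :: "('s, 'a) ma \<Rightarrow> bool" where
  "action_deterministic M \<longleftrightarrow>
     (\<forall>s \<alpha> \<mu> \<mu>'. (s, Inl \<alpha>, \<mu>) \<in> ma_trans M \<and> (s, Inl \<alpha>, \<mu>') \<in> ma_trans M \<longrightarrow> \<mu> = \<mu>')"

definition deadlock_free :: "('s, 'a) ma \<Rightarrow> bool" where
  "deadlock_free M \<longleftrightarrow> (\<forall>s. \<exists>\<gamma> \<mu>. (s, \<gamma>, \<mu>) \<in> ma_trans M)"

definition maximal_progress :: "('s, 'a) ma \<Rightarrow> bool" where
  "maximal_progress M \<longleftrightarrow> PS M \<union> MS M = UNIV \<and> PS M \<inter> MS M = {}"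

text \<open>Labels of paths are \<open>Inl \<alpha>\<close> for actions and \<open>Inr t\<close> for sojourn times.\<close>

fun label_time :: "'a + real \<Rightarrow> real" where
  "label_time (Inl \<alpha>) = 0"
| "label_time (Inr t) = t"

fun label_act :: "('s, 'a) ma \<Rightarrow> 'a + real \<Rightarrow> 'a" where
  "label_act M (Inl \<alpha>) = \<alpha>"
| "label_act M (Inr t) = ma_bot M"

definition ma_step :: "('s, 'a) ma \<Rightarrow> 's \<Rightarrow> 'a + real \<Rightarrow> 's \<Rightarrow> bool" where
  "ma_step M s \<kappa> s' \<longleftrightarrow>
     (case \<kappa> of Inl \<alpha> \<Rightarrow> s \<in> PS M | Inr t \<Rightarrow> s \<in> MS M \<and> t \<ge> 0) \<and>
     ma_prob M s (label_act M \<kappa>) s' > 0"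

definition ma_paths :: "('s, 'a) ma \<Rightarrow> (('a + real) \<times> 's) list set" where
  "ma_paths M = {\<pi>. is_path (ma_step M) (ma_init M) \<pi>}"

definition label_space :: "('a + real) measure" where
  "label_space = sigma UNIV ({Inl ` A |A. True} \<union> {Inr ` B |B. B \<in> sets borel})"

definition step_space :: "(('a + real) \<times> 's) measure" where
  "step_space = label_space \<Otimes>\<^sub>M count_space UNIV"

text \<open>
  Schedulers are total functions on label/state sequences. Their values on sequences that are not
  paths are irrelevant, as these are null under the induced measure; asking for measurability on all
  sequences is no restriction, since the paths of length \<open>n\<close> form a measurable set.
\<close>

definition ma_scheduler :: "('s, 'a) ma \<Rightarrow> ((('a + real) \<times> 's) list \<Rightarrow> 'a pmf) \<Rightarrow> bool" where
  "ma_scheduler M \<sigma> \<longleftrightarrow>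
     (\<forall>\<pi>\<in>ma_paths M. set_pmf (\<sigma> \<pi>) \<subseteq> enabled (ma_prob M) (last_state (ma_init M) \<pi>)) \<and>
     (\<forall>n \<alpha>. (\<lambda>\<omega>. pmf (\<sigma> (prefix_path \<omega> n)) \<alpha>)
               \<in> borel_measurable (PiM {0..<n} (\<lambda>_. step_space)))"

definition prob_step :: "('s \<Rightarrow> 'a \<Rightarrow> 's \<Rightarrow> real) \<Rightarrow> 's \<Rightarrow> 'a pmf \<Rightarrow> ('a \<times> 's) pmf" where
  "prob_step P s D = bind_pmf D (\<lambda>\<alpha>. map_pmf (Pair \<alpha>) (embed_pmf (P s \<alpha>)))"

definition ma_kernel ::
  "('s, 'a) ma \<Rightarrow> ((('a + real) \<times> 's) list \<Rightarrow> 'a pmf) \<Rightarrow> (('a + real) \<times> 's) list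
     \<Rightarrow> (('a + real) \<times> 's) measure" where
  "ma_kernel M \<sigma> \<pi> =
     (let s = last_state (ma_init M) \<pi> in
      if s \<in> PS M
      then distr (measure_pmf (prob_step (ma_prob M) s (\<sigma> \<pi>))) step_space (\<lambda>(\<alpha>, s'). (Inl \<alpha>, s'))
      else distr (density lborel (exponential_density (exit_rate M s))
                    \<Otimes>\<^sub>M measure_pmf (embed_pmf (ma_prob M s (ma_bot M))))
             step_space (\<lambda>(t, s'). (Inr t, s')))"

definition ma_measure ::
  "('s, 'a) ma \<Rightarrow> ((('a + real) \<times> 's) list \<Rightarrow> 'a pmf) \<Rightarrow> (nat \<Rightarrow> ('a + real) \<times> 's) measure" where
  "ma_measure M \<sigma> = path_measure (ma_kernel M \<sigma>) step_space"

text \<open>Sojourn times are almost surely nonnegative, so non-summability says that time diverges.\<close>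

definition non_zeno :: "('s, 'a) ma \<Rightarrow> bool" where
  "non_zeno M \<longleftrightarrow>
     (\<forall>\<sigma>. ma_scheduler M \<sigma> \<longrightarrow>
        (AE \<omega> in ma_measure M \<sigma>. \<not> summable (\<lambda>i. label_time (fst (\<omega> i)))))"

definition ma_step_reward :: "('s, 'a) ma \<Rightarrow> nat \<Rightarrow> 's \<Rightarrow> 'a + real \<Rightarrow> real" where
  "ma_step_reward M j s \<kappa> =
     (ma_rewards M ! j) (Inl s) * label_time \<kappa> + (ma_rewards M ! j) (Inr (s, label_act M \<kappa>))"

definition ma_value ::
  "('s, 'a) ma \<Rightarrow> ((('a + real) \<times> 's) list \<Rightarrow> 'a pmf) \<Rightarrow> 's objective \<Rightarrow> ereal" where
  "ma_value M \<sigma> = objective_value (ma_measure M \<sigma>) (ma_init M) (ma_step_reward M)"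

definition ma_achieve ::
  "('s, 'a) ma \<Rightarrow> 's objective list \<Rightarrow> (ereal \<Rightarrow> ereal \<Rightarrow> bool) list \<Rightarrow> real list \<Rightarrow> bool" where
  "ma_achieve M Os rels p \<longleftrightarrow> (\<exists>\<sigma>. ma_scheduler M \<sigma> \<and> satisfies_all (ma_value M \<sigma>) Os rels p)"


record ('s, 'a) mdp =
  mdp_prob :: "'s \<Rightarrow> 'a \<Rightarrow> 's \<Rightarrow> real"
  mdp_init :: 's
  mdp_rewards :: "('s \<times> 'a \<Rightarrow> real) list"

definition mdp_paths :: "('s, 'a) mdp \<Rightarrow> ('a \<times> 's) list set" where
  "mdp_paths D = {\<pi>. is_path (\<lambda>s \<alpha> s'. mdp_prob D s \<alpha> s' > 0) (mdp_init D) \<pi>}"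

definition mdp_scheduler :: "('s, 'a) mdp \<Rightarrow> (('a \<times> 's) list \<Rightarrow> 'a pmf) \<Rightarrow> bool" where
  "mdp_scheduler D \<sigma> \<longleftrightarrow>
     (\<forall>\<pi>\<in>mdp_paths D. set_pmf (\<sigma> \<pi>) \<subseteq> enabled (mdp_prob D) (last_state (mdp_init D) \<pi>))"

definition mdp_kernel ::
  "('s, 'a) mdp \<Rightarrow> (('a \<times> 's) list \<Rightarrow> 'a pmf) \<Rightarrow> ('a \<times> 's) list \<Rightarrow> ('a \<times> 's) measure" where
  "mdp_kernel D \<sigma> \<pi> = measure_pmf (prob_step (mdp_prob D) (last_state (mdp_init D) \<pi>) (\<sigma> \<pi>))"

definition mdp_measure ::
  "('s, 'a) mdp \<Rightarrow> (('a \<times> 's) list \<Rightarrow> 'a pmf) \<Rightarrow> (nat \<Rightarrow> 'a \<times> 's) measure" where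
  "mdp_measure D \<sigma> = path_measure (mdp_kernel D \<sigma>) (count_space UNIV)"

definition mdp_value ::
  "('s, 'a) mdp \<Rightarrow> (('a \<times> 's) list \<Rightarrow> 'a pmf) \<Rightarrow> 's objective \<Rightarrow> ereal" where
  "mdp_value D \<sigma> =
     objective_value (mdp_measure D \<sigma>) (mdp_init D) (\<lambda>j s \<alpha>. (mdp_rewards D ! j) (s, \<alpha>))"

definition mdp_achieve ::
  "('s, 'a) mdp \<Rightarrow> 's objective list \<Rightarrow> (ereal \<Rightarrow> ereal \<Rightarrow> bool) list \<Rightarrow> real list \<Rightarrow> bool" where
  "mdp_achieve D Os rels p \<longleftrightarrow> (\<exists>\<sigma>. mdp_scheduler D \<sigma> \<and> satisfies_all (mdp_value D \<sigma>) Os rels p)"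

definition underlying_reward ::
  "('s, 'a) ma \<Rightarrow> ('s + 's \<times> 'a \<Rightarrow> real) \<Rightarrow> 's \<times> 'a \<Rightarrow> real" where
  "underlying_reward M \<rho> = (\<lambda>(s, \<alpha>).
     if s \<in> PS M then \<rho> (Inr (s, \<alpha>))
     else if s \<in> MS M \<and> \<alpha> = ma_bot M then \<rho> (Inr (s, ma_bot M)) + \<rho> (Inl s) / exit_rate M s
     else 0)"

definition underlying_mdp :: "('s, 'a) ma \<Rightarrow> ('s, 'a) mdp" where
  "underlying_mdp M =
     \<lparr>mdp_prob = ma_prob M, mdp_init = ma_init M,
      mdp_rewards = map (underlying_reward M) (ma_rewards M)\<rparr>"

end

theory Submission
  imports Defs
begin

text \<open>
  Erasing sojourn times maps the paths of the automaton to those of its underlying MDP. A scheduler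
  \<open>\<sigma>\<close> of the automaton and a scheduler \<open>\<tau>\<close> of the MDP induce the same distribution on erased paths
  as soon as \<open>\<tau> w\<close> is the conditional expectation of \<open>\<sigma>\<close> given that the erased prefix is \<open>w\<close>, because
  the next state depends on the past only through the last state and the chosen action. For given
  \<open>\<sigma>\<close> such a \<open>\<tau>\<close> exists, as there are only countably many erased prefixes; for given \<open>\<tau>\<close>, take
  \<open>\<sigma>\<close> to be \<open>\<tau>\<close> after erasure. Reachability depends on the erased path only. The expected reward is
  the sum over \<open>n\<close> of the expected reward of step \<open>n\<close> on the event that the goal has not been
  visited, and given the past, a step in a Markovian state \<open>s\<close> earns
  \<open>\<rho>(s,\<bottom>) + \<rho>(s) / E(s)\<close> on average, since the mean sojourn time is \<open>1 / E(s)\<close>.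
\<close>

section \<open>Path measures\<close>

lemma prefix_path_restrict [simp]: "prefix_path (restrict \<omega> {0..<n}) n = prefix_path \<omega> n"
  by (auto simp: prefix_path_def)

lemma prefix_path_upd [simp]: "prefix_path (fun_upd \<omega> n x) n = prefix_path \<omega> n"
  by (auto simp: prefix_path_def)

lemma prefix_path_Suc: "prefix_path \<omega> (Suc n) = prefix_path \<omega> n @ [\<omega> n]"
  by (simp add: prefix_path_def)

lemma prefix_path_0 [simp]: "prefix_path \<omega> 0 = []"
  by (simp add: prefix_path_def)

lemma length_prefix_path [simp]: "length (prefix_path \<omega> n) = n"
  by (simp add: prefix_path_def)

lemma prefix_path_comp: "prefix_path (\<lambda>i. T (\<omega> i)) n = map T (prefix_path \<omega> n)"
  by (simp add: prefix_path_def)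

lemma map_prefix_path_eq_iff:
  "map T (prefix_path \<omega> n) = w \<longleftrightarrow> length w = n \<and> (\<forall>i<n. T (\<omega> i) = w ! i)"
  unfolding prefix_path_def list_eq_iff_nth_eq by auto

text \<open>Lists over a countable type are countable, so preimages of single lists suffice, and
  each of these is a finite conjunction of conditions on coordinates.\<close>

lemma measurable_map_prefix_path:
  fixes T :: "'l \<times> 's \<Rightarrow> 'b::countable"
  assumes T: "T \<in> measurable N (count_space UNIV)" and "{0..<n} \<subseteq> I"
  shows "(\<lambda>\<omega>. map T (prefix_path \<omega> n)) \<in> measurable (PiM I (\<lambda>_. N)) (count_space UNIV)"
proof (subst measurable_count_space_eq2_countable, intro conjI ballI)
  fix w :: "'b list"
  have "(\<lambda>\<omega>. map T (prefix_path \<omega> n)) -` {w} \<inter> space (PiM I (\<lambda>_. N)) =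
    {\<omega> \<in> space (PiM I (\<lambda>_. N)). length w = n \<and> (\<forall>i\<in>{0..<n}. T (\<omega> i) = w ! i)}"
    unfolding vimage_def singleton_iff map_prefix_path_eq_iff by auto
  also have "\<dots> \<in> sets (PiM I (\<lambda>_. N))"
  proof -
    have "(\<lambda>\<omega>. T (\<omega> i)) \<in> measurable (PiM I (\<lambda>_. N)) (count_space UNIV)" if "i \<in> {0..<n}" for i
      using T that assms(2) by (auto intro!: measurable_compose[OF measurable_component_singleton])
    then show ?thesis
      by measurable
  qed
  finally show "(\<lambda>\<omega>. map T (prefix_path \<omega> n)) -` {w} \<inter> space (PiM I (\<lambda>_. N)) \<in> sets (PiM I (\<lambda>_. N))" .
qed auto

lemma measurable_prefix_path_step:
  fixes T :: "'l \<times> 's \<Rightarrow> 'b::countable"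
  assumes T: "T \<in> measurable N (count_space UNIV)" and H: "\<And>w. H w \<in> borel_measurable N"
    and I: "{0..<Suc n} \<subseteq> I"
  shows "(\<lambda>\<omega>. H (map T (prefix_path \<omega> n)) (\<omega> n)) \<in> borel_measurable (PiM I (\<lambda>_. N))"
proof -
  have n: "(\<lambda>\<omega>. \<omega> n) \<in> measurable (PiM I (\<lambda>_. N)) N"
    using I by (intro measurable_component_singleton) auto
  show ?thesis
    by (rule measurable_compose_countable[OF measurable_compose[OF n H] measurable_map_prefix_path[OF T]])
       (use I in auto)
qed

text \<open>These are the hypotheses of the Ionescu-Tulcea theorem, for kernels that read the past
  as a list instead of a point of a product space.\<close>

locale path_kernel =
  fixes K :: "('l \<times> 's) list \<Rightarrow> ('l \<times> 's) measure" and N :: "('l \<times> 's) measure"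
  assumes measurable_K:
      "\<And>n. (\<lambda>\<omega>. K (prefix_path \<omega> n)) \<in> measurable (PiM {0..<n} (\<lambda>_. N)) (subprob_algebra N)"
    and prob_space_K: "\<And>\<pi>. prob_space (K \<pi>)"
begin

sublocale IT: Ionescu_Tulcea "\<lambda>n \<omega>. K (prefix_path \<omega> n)" "\<lambda>_. N"
  by (rule Ionescu_Tulcea.intro) (rule measurable_K, rule prob_space_K)

lemma sets_path_measure [simp, measurable_cong]:
  "sets (path_measure K N) = sets (PiM UNIV (\<lambda>_. N))"
  unfolding path_measure_def by (rule IT.PF.sets_lim)

lemma space_path_measure: "space (path_measure K N) = space (PiM UNIV (\<lambda>_. N))"
  by (rule sets_eq_imp_space_eq) simp

text \<open>The projective limit has the iterated kernels \<open>IT.C\<close> as its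
  finite-dimensional marginals. This reduces integrals of functions of finitely many steps to the
  recursive definition of \<open>IT.C\<close>.\<close>

lemma distr_restrict_path_measure:
  "distr (path_measure K N) (PiM {0..<n} (\<lambda>_. N)) (\<lambda>\<omega>. restrict \<omega> {0..<n}) = IT.C 0 n (\<lambda>_. undefined)"
proof (rule measure_eqI)
  \<comment> \<open>The constant \<open>undefined\<close> is the only point of the empty product,
    hence the starting point of the iteration.\<close>
  have undef: "(\<lambda>_::nat. undefined) \<in> space (PiM {0..<0} (\<lambda>_. N))"
    by (auto simp: space_PiM PiE_def extensional_def)
  show "sets (distr (path_measure K N) (PiM {0..<n} (\<lambda>_. N)) (\<lambda>\<omega>. restrict \<omega> {0..<n})) =
      sets (IT.C 0 n (\<lambda>_. undefined))"
    using IT.sets_C[OF undef, of n] by simp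
  fix X assume "X \<in> sets (distr (path_measure K N) (PiM {0..<n} (\<lambda>_. N)) (\<lambda>\<omega>. restrict \<omega> {0..<n}))"
  then have X: "X \<in> sets (PiM {0..<n} (\<lambda>_. N))" by simp
  have "emeasure (distr (path_measure K N) (PiM {0..<n} (\<lambda>_. N)) (\<lambda>\<omega>. restrict \<omega> {0..<n})) X =
      emeasure (path_measure K N) (prod_emb UNIV (\<lambda>_. N) {0..<n} X)"
    using X by (intro emeasure_distr_restrict) auto
  also have "\<dots> = IT.C 0 n (\<lambda>_. undefined) (prod_emb {0..<n} (\<lambda>_. N) {0..<n} X)"
    unfolding path_measure_def using X by (simp add: IT.lim IT.emeasure_CI)
  also have "prod_emb {0..<n} (\<lambda>_. N) {0..<n} X = X"
    using sets.sets_into_space[OF X] by (simp add: prod_emb_id space_PiM)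
  finally show "emeasure (distr (path_measure K N) (PiM {0..<n} (\<lambda>_. N)) (\<lambda>\<omega>. restrict \<omega> {0..<n})) X =
      emeasure (IT.C 0 n (\<lambda>_. undefined)) X" .
qed

text \<open>The marginal on the empty index set already carries the total mass, because a
  pushforward preserves it.\<close>

lemma prob_space_path_measure: "prob_space (path_measure K N)"
proof -
  have "prob_space (distr (path_measure K N) (PiM {0..<0} (\<lambda>_. N)) (\<lambda>\<omega>. restrict \<omega> {0..<0}))"
    unfolding distr_restrict_path_measure by (rule IT.prob_space_C) (auto simp: space_PiM PiE_def extensional_def)
  then show ?thesis
    by (rule prob_space_distrD[rotated]) (auto intro!: measurable_restrict)
qed

lemma nn_integral_restrict:
  assumes "f \<in> borel_measurable (PiM {0..<n} (\<lambda>_. N))"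
  shows "(\<integral>\<^sup>+\<omega>. f (restrict \<omega> {0..<n}) \<partial>path_measure K N) = (\<integral>\<^sup>+\<omega>. f \<omega> \<partial>IT.C 0 n (\<lambda>_. undefined))"
  using assms
  by (subst distr_restrict_path_measure[symmetric], subst nn_integral_distr)
     (auto intro!: measurable_restrict)

text \<open>Integrating out step \<open>n\<close> given the past: the marginal of length
  \<open>Suc n\<close> is the marginal of length \<open>n\<close> bound to the kernel. The past
  enters the integrand through a countable image, which makes measurability of each
  \<open>H w\<close> enough, while the current step enters in full, so that \<open>H\<close> may
  still read a sojourn time.\<close>

lemma nn_integral_step:
  fixes T :: "('l \<times> 's) \<Rightarrow> 'b::countable"
  assumes T: "T \<in> measurable N (count_space UNIV)"
    and H: "\<And>w. H w \<in> borel_measurable N"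
  shows "(\<integral>\<^sup>+\<omega>. H (map T (prefix_path \<omega> n)) (\<omega> n) \<partial>path_measure K N) =
    (\<integral>\<^sup>+\<omega>. (\<integral>\<^sup>+x. H (map T (prefix_path \<omega> n)) x \<partial>K (prefix_path \<omega> n)) \<partial>path_measure K N)"
proof -
  let ?H = "\<lambda>\<omega>. H (map T (prefix_path \<omega> n))"
  have undef: "(\<lambda>_::nat. undefined) \<in> space (PiM {0..<0} (\<lambda>_. N))"
    by (auto simp: space_PiM PiE_def extensional_def)
  have 1: "(\<lambda>\<omega>. ?H \<omega> (\<omega> n)) \<in> borel_measurable (PiM {0..<Suc n} (\<lambda>_. N))"
    by (rule measurable_prefix_path_step[OF T H]) simp
  have "(\<lambda>(\<omega>, x). ?H \<omega> x) \<in> borel_measurable (PiM {0..<n} (\<lambda>_. N) \<Otimes>\<^sub>M N)"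
    unfolding split_beta'
    by (rule measurable_compose_countable[OF measurable_compose[OF measurable_snd H]
          measurable_compose[OF measurable_fst measurable_map_prefix_path[OF T]]]) simp
  then have 2: "(\<lambda>\<omega>. \<integral>\<^sup>+x. ?H \<omega> x \<partial>K (prefix_path \<omega> n)) \<in> borel_measurable (PiM {0..<n} (\<lambda>_. N))"
    by (rule nn_integral_measurable_subprob_algebra2[OF _ measurable_K])
  have "(\<integral>\<^sup>+\<omega>. ?H \<omega> (\<omega> n) \<partial>path_measure K N) =
     (\<integral>\<^sup>+\<omega>. (\<lambda>\<omega>. ?H \<omega> (\<omega> n)) (restrict \<omega> {0..<Suc n}) \<partial>path_measure K N)"
    by (rule nn_integral_cong) (auto simp: prefix_path_def intro!: arg_cong2[of _ _ _ _ H])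
  also have "\<dots> = (\<integral>\<^sup>+\<omega>. ?H \<omega> (\<omega> n) \<partial>IT.C 0 (Suc n) (\<lambda>_. undefined))"
    by (rule nn_integral_restrict[OF 1])
  also have "\<dots> = (\<integral>\<^sup>+\<omega>. \<integral>\<^sup>+\<omega>'. ?H \<omega>' (\<omega>' n) \<partial>IT.eP n \<omega> \<partial>IT.C 0 n (\<lambda>_. undefined))"
    unfolding IT.C.simps add_0
  proof (rule nn_integral_bind[OF 1])
    show "IT.eP n \<in> measurable (IT.C 0 n (\<lambda>_. undefined)) (subprob_algebra (PiM {0..<Suc n} (\<lambda>_. N)))"
      using IT.measurable_eP[of n] IT.sets_C[OF undef, of n]
      by (simp cong: measurable_cong_sets)
  qed
  also have "\<dots> = (\<integral>\<^sup>+\<omega>. \<integral>\<^sup>+x. ?H \<omega> x \<partial>K (prefix_path \<omega> n) \<partial>IT.C 0 n (\<lambda>_. undefined))"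
  proof (rule nn_integral_cong)
    fix \<omega> assume "\<omega> \<in> space (IT.C 0 n (\<lambda>_. undefined))"
    then have "\<omega> \<in> space (PiM {0..<n} (\<lambda>_. N))"
      using IT.space_C[OF undef, of n] by simp
    then show "(\<integral>\<^sup>+\<omega>'. ?H \<omega>' (\<omega>' n) \<partial>IT.eP n \<omega>) = (\<integral>\<^sup>+x. ?H \<omega> x \<partial>K (prefix_path \<omega> n))"
      by (subst IT.nn_integral_eP[OF _ 1]) simp_all
  qed
  also have "\<dots> = (\<integral>\<^sup>+\<omega>. \<integral>\<^sup>+x. ?H \<omega> x \<partial>K (prefix_path \<omega> n) \<partial>path_measure K N)"
    by (subst nn_integral_restrict[OF 2, symmetric]) simp
  finally show ?thesis .
qed

end

text \<open>A rectangle over finitely many coordinates below \<open>n\<close> is a countable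
  disjoint union of cylinders of prefixes of length \<open>n\<close>, and such rectangles determine
  a finite measure on the product.\<close>

lemma path_measure_eqI:
  fixes A B :: "(nat \<Rightarrow> 'l::countable \<times> 's::countable) measure"
  assumes A: "sets A = sets (PiM UNIV (\<lambda>_. count_space UNIV))" "prob_space A"
    and B: "sets B = sets (PiM UNIV (\<lambda>_. count_space UNIV))"
    and eq: "\<And>n w. emeasure A {\<omega>. prefix_path \<omega> n = w} = emeasure B {\<omega>. prefix_path \<omega> n = w}"
  shows "A = B"
proof (rule measure_eqI_PiM_infinite[where M="\<lambda>_. count_space UNIV" and I=UNIV])
  interpret prob_space A by fact
  show "finite_measure A" by (rule finite_measure_axioms)
  have [simp]: "space A = UNIV" "space B = UNIV"
    using sets_eq_imp_space_eq[OF A(1)] sets_eq_imp_space_eq[OF B] by (auto simp: space_PiM)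
  fix X :: "nat \<Rightarrow> ('l \<times> 's) set" and J :: "nat set" assume J: "finite J"
  then obtain n where n: "J \<subseteq> {0..<n}"
    by (metis finite_nat_iff_bounded lessThan_atLeast0)
  define W where "W = {w. length w = n \<and> (\<forall>i\<in>J. w ! i \<in> X i)}"
  have cyl: "{\<omega>. prefix_path \<omega> n = w} \<in> sets (PiM UNIV (\<lambda>_::nat. count_space (UNIV::('l\<times>'s) set)))" for w
    using measurable_sets[OF measurable_map_prefix_path[of id "count_space UNIV" n UNIV], of "{w}"]
    by (simp add: vimage_def space_PiM)
  have "prod_emb UNIV (\<lambda>_. count_space UNIV) J (PiE J X) = (\<Union>w\<in>W. {\<omega>. prefix_path \<omega> n = w})"
    using n by (fastforce simp: prod_emb_def W_def prefix_path_def)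
  moreover have "emeasure A (\<Union>w\<in>W. {\<omega>. prefix_path \<omega> n = w}) = emeasure B (\<Union>w\<in>W. {\<omega>. prefix_path \<omega> n = w})"
    by (subst (1 2) emeasure_UN_countable)
       (auto simp: cyl eq A B disjoint_family_on_def)
  ultimately show "emeasure A (prod_emb UNIV (\<lambda>_. count_space UNIV) J (PiE J X)) =
     emeasure B (prod_emb UNIV (\<lambda>_. count_space UNIV) J (PiE J X))"
    by simp
qed (use A B in auto)


section \<open>Accumulated rewards\<close>

lemma last_state_snoc [simp]: "last_state s (\<pi> @ [x]) = snd x"
  by (simp add: last_state_def)

lemma last_state_Cons: "last_state s (x # \<pi>) = last_state (snd x) \<pi>"
  by (simp add: last_state_def)

lemma last_state_map: "(\<And>x. snd (T x) = snd x) \<Longrightarrow> last_state s (map T \<pi>) = last_state s \<pi>"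
  by (simp add: last_state_def last_map)

lemma is_path_snoc:
  "is_path R s (\<pi> @ [(\<kappa>, s')]) \<longleftrightarrow> is_path R s \<pi> \<and> R (last_state s \<pi>) \<kappa> s'"
  by (induction R s \<pi> rule: is_path.induct) (auto simp: last_state_Cons, auto simp: last_state_def)

lemma state_at_eq_last_state: "state_at s \<omega> n = last_state s (prefix_path \<omega> n)"
  by (cases n) (simp_all add: state_at_def prefix_path_Suc, simp add: last_state_def)

lemma state_at_comp: "(\<And>x. snd (T x) = snd x) \<Longrightarrow> state_at s (\<lambda>i. T (\<omega> i)) n = state_at s \<omega> n"
  by (simp add: state_at_def split: nat.split)

text \<open>A condition on lists, so that it can be evaluated on erased prefixes. The last state is
  included because step \<open>n\<close> is rewarded only if its source state comes before the first
  visit to the goal.\<close>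

definition avoids :: "'s \<Rightarrow> 's set \<Rightarrow> ('l \<times> 's) list \<Rightarrow> bool" where
  "avoids s G \<pi> \<longleftrightarrow> (\<forall>m\<le>length \<pi>. last_state s (take m \<pi>) \<notin> G)"

lemma avoids_prefix_path: "avoids s G (prefix_path \<omega> n) \<longleftrightarrow> (\<forall>m\<le>n. state_at s \<omega> m \<notin> G)"
  by (auto simp: avoids_def state_at_eq_last_state prefix_path_def take_map min_def)

lemma avoids_map: "(\<And>x. snd (T x) = snd x) \<Longrightarrow> avoids s G (map T \<pi>) \<longleftrightarrow> avoids s G \<pi>"
  by (simp add: avoids_def take_map last_state_map)

text \<open>One series covers both cases of \<open>reward_upto\<close>, and its terms can be
  integrated separately. Nonnegativity is what lets \<open>ennreal\<close> commute with the partial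
  sums.\<close>

lemma reward_upto_eq_suminf:
  assumes nonneg: "\<And>i. 0 \<le> c (state_at s \<omega> i) (fst (\<omega> i))"
  shows "reward_upto s c G \<omega> =
    (\<Sum>n. of_bool (avoids s G (prefix_path \<omega> n)) * ennreal (c (last_state s (prefix_path \<omega> n)) (fst (\<omega> n))))"
proof (cases "\<exists>n. state_at s \<omega> n \<in> G")
  case True
  define N where "N = (LEAST n. state_at s \<omega> n \<in> G)"
  have N: "state_at s \<omega> N \<in> G"
    unfolding N_def using True by (rule LeastI_ex)
  \<comment> \<open>\<open>N\<close> is the first hitting time, and \<open>prefix_reward\<close> up
    to \<open>N\<close> sums exactly the steps with index below \<open>N\<close>.\<close>
  have avoid: "avoids s G (prefix_path \<omega> n) \<longleftrightarrow> n < N" for n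
    using N not_less_Least[of _ "\<lambda>n. state_at s \<omega> n \<in> G"]
    unfolding avoids_prefix_path N_def[symmetric]
    by (metis leI le_less_trans)
  have "(\<Sum>n. of_bool (avoids s G (prefix_path \<omega> n)) * ennreal (c (last_state s (prefix_path \<omega> n)) (fst (\<omega> n)))) =
      (\<Sum>n<N. of_bool (avoids s G (prefix_path \<omega> n)) * ennreal (c (last_state s (prefix_path \<omega> n)) (fst (\<omega> n))))"
    by (rule suminf_finite) (auto simp: avoid)
  also have "\<dots> = ennreal (prefix_reward s c \<omega> N)"
    using nonneg by (simp add: prefix_reward_def avoid state_at_eq_last_state sum_ennreal)
  finally show ?thesis
    using True by (simp add: reward_upto_def N_def)
next
  case False
  \<comment> \<open>Partial sums of a series in \<open>ennreal\<close> converge, so the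
    \<open>lim\<close> in \<open>reward_upto\<close> is a genuine limit.\<close>
  have "(\<lambda>n. \<Sum>i<n. ennreal (c (state_at s \<omega> i) (fst (\<omega> i)))) \<longlonglongrightarrow> (\<Sum>i. ennreal (c (state_at s \<omega> i) (fst (\<omega> i))))"
    by (rule summable_LIMSEQ) simp
  then have "(\<lambda>n. ennreal (prefix_reward s c \<omega> n)) \<longlonglongrightarrow> (\<Sum>i. ennreal (c (state_at s \<omega> i) (fst (\<omega> i))))"
    using nonneg by (simp add: prefix_reward_def sum_ennreal)
  moreover have "avoids s G (prefix_path \<omega> n)" for n
    using False by (simp add: avoids_prefix_path)
  ultimately show ?thesis
    using False by (simp add: reward_upto_def limI state_at_eq_last_state)
qed

section \<open>Steps of a Markov automaton\<close>

lemma space_label_space [simp]: "space label_space = UNIV"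
  by (simp add: label_space_def)

lemma sets_label_space:
  "sets label_space = sigma_sets UNIV ({Inl ` A |A. True} \<union> {Inr ` B |B. B \<in> sets borel})"
  by (simp add: label_space_def)

lemma measurable_Inr_label_space: "Inr \<in> measurable borel label_space"
proof (rule measurable_sigma_sets[OF sets_label_space])
  fix y :: "('a + real) set" assume "y \<in> {Inl ` A |A. True} \<union> {Inr ` B |B. B \<in> sets borel}"
  then show "Inr -` y \<inter> space borel \<in> sets borel"
    by (auto simp: vimage_def image_iff)
qed auto

text \<open>The label space is the disjoint sum of the discrete space of actions and the Borel line,
  so a preimage splits into an arbitrary set of actions and a Borel set of times.\<close>

lemma measurable_label_spaceI:
  assumes "\<And>a. f (Inl a) \<in> space X" and Inr: "(\<lambda>t. f (Inr t)) \<in> measurable borel X"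
  shows "f \<in> measurable label_space X"
proof (rule measurableI)
  show "f x \<in> space X" for x
    using assms(1) measurable_space[OF Inr] by (cases x) auto
  fix B assume B: "B \<in> sets X"
  have "f -` B \<inter> space label_space = Inl ` {a. f (Inl a) \<in> B} \<union> Inr ` {t. f (Inr t) \<in> B}"
  proof (intro set_eqI)
    show "x \<in> f -` B \<inter> space label_space \<longleftrightarrow> x \<in> Inl ` {a. f (Inl a) \<in> B} \<union> Inr ` {t. f (Inr t) \<in> B}" for x
      by (cases x) auto
  qed
  moreover have "Inl ` {a. f (Inl a) \<in> B} \<in> sets label_space"
    unfolding sets_label_space by (rule sigma_sets.Basic) blast
  moreover have "Inr ` {t. f (Inr t) \<in> B} \<in> sets label_space"
    unfolding sets_label_space using measurable_sets[OF Inr B]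
    by (intro sigma_sets.Basic) (auto simp: vimage_def)
  ultimately show "f -` B \<inter> space label_space \<in> sets label_space"
    using sets.Un by metis
qed

lemma space_step_space [simp]: "space step_space = UNIV"
  by (simp add: step_space_def space_pair_measure)

text \<open>There are countably many states, so measurability may be checked with the state held
  fixed; what remains is measurability in the sojourn time.\<close>

lemma measurable_step_spaceI:
  fixes f :: "('a + real) \<times> 's::countable \<Rightarrow> 'b"
  assumes "\<And>a s. f (Inl a, s) \<in> space X" and "\<And>s. (\<lambda>t. f (Inr t, s)) \<in> measurable borel X"
  shows "f \<in> measurable step_space X"
proof -
  have "(\<lambda>x. f (fst x, s)) \<in> measurable step_space X" for s
    unfolding step_space_def
    by (rule measurable_compose[OF measurable_fst measurable_label_spaceI]) (rule assms)+
  then have "(\<lambda>x. f (fst x, snd x)) \<in> measurable step_space X"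
    by (rule measurable_compose_countable) (simp add: step_space_def)
  then show ?thesis by simp
qed

text \<open>Only the branch in which \<open>\<alpha>\<close> is drawn can produce a pair with first
  component \<open>\<alpha>\<close>.\<close>

lemma pmf_prob_step:
  fixes D :: "'a::finite pmf"
  shows "pmf (prob_step P s D) (\<alpha>, s') = pmf D \<alpha> * pmf (embed_pmf (P s \<alpha>)) s'"
proof -
  have "pmf (map_pmf (Pair \<alpha>') (embed_pmf (P s \<alpha>'))) (\<alpha>, s') =
      of_bool (\<alpha>' = \<alpha>) * pmf (embed_pmf (P s \<alpha>)) s'" for \<alpha>'
  proof (cases "\<alpha>' = \<alpha>")
    case True
    then show ?thesis
      using pmf_map_inj'[of "Pair \<alpha>" "embed_pmf (P s \<alpha>)" s'] by (simp add: inj_def)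
  next
    case False
    then have "pmf (map_pmf (Pair \<alpha>') (embed_pmf (P s \<alpha>'))) (\<alpha>, s') = 0"
      by (subst pmf_eq_0_set_pmf) auto
    with False show ?thesis
      by simp
  qed
  then show ?thesis
    by (simp add: prob_step_def pmf_bind integral_measure_pmf_real[of UNIV] mult.commute
        mult.left_commute)
qed

definition erase :: "('s, 'a) ma \<Rightarrow> ('a + real) \<times> 's \<Rightarrow> 'a \<times> 's" where
  "erase M = (\<lambda>(\<kappa>, s). (label_act M \<kappa>, s))"

lemma erase_simps [simp]:
  "erase M (Inl \<alpha>, s) = (\<alpha>, s)" "erase M (Inr t, s) = (ma_bot M, s)" "snd (erase M x) = snd x"
  by (simp_all add: erase_def split_beta)

lemma measurable_erase: "erase M \<in> measurable step_space (count_space (UNIV :: ('a \<times> 's::countable) set))"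
  by (rule measurable_step_spaceI) simp_all

text \<open>The exponential density is the Erlang density of shape 0, and its zeroth moment is the
  total mass 1.\<close>

lemma nn_integral_exponential_const:
  "0 < l \<Longrightarrow> (\<integral>\<^sup>+t. ennreal (exponential_density l t) * c \<partial>lborel) = c"
  using nn_integral_erlang_ith_moment[of l 0 0] by (simp add: nn_integral_multc)

text \<open>A combination of the zeroth and first moments, the mean being
  \<open>1 / l\<close>.\<close>

lemma nn_integral_exponential_affine:
  assumes "0 < l" "0 \<le> a" "0 \<le> b"
  shows "(\<integral>\<^sup>+t. ennreal (exponential_density l t) * ennreal (a * t + b) \<partial>lborel) = ennreal (a / l + b)"
proof -
  \<comment> \<open>For negative \<open>t\<close> both sides vanish with the density; elsewhere all
    summands are nonnegative, so \<open>ennreal\<close> is additive on them.\<close>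
  have "ennreal (exponential_density l t) * ennreal (a * t + b) =
      ennreal a * ennreal (exponential_density l t * t ^ 1) + ennreal b * ennreal (exponential_density l t * t ^ 0)" for t
    using assms
    by (cases "t < 0")
       (simp_all add: exponential_density_def ennreal_mult[symmetric] ennreal_plus[symmetric] algebra_simps
          del: ennreal_plus)
  then have "(\<integral>\<^sup>+t. ennreal (exponential_density l t) * ennreal (a * t + b) \<partial>lborel) =
      ennreal a * (\<integral>\<^sup>+t. ennreal (exponential_density l t * t ^ 1) \<partial>lborel) +
      ennreal b * (\<integral>\<^sup>+t. ennreal (exponential_density l t * t ^ 0) \<partial>lborel)"
    by (simp add: nn_integral_add nn_integral_cmult)
  also have "\<dots> = ennreal (a / l + b)"
    using assms
    by (simp only: nn_integral_erlang_ith_moment)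
       (simp add: ennreal_mult[symmetric] ennreal_plus[symmetric] del: ennreal_plus)
  finally show ?thesis .
qed

section \<open>Markov automata and their underlying MDPs\<close>

locale valid_ma =
  fixes M :: "('s::finite, 'a::finite) ma"
  assumes automaton: "markov_automaton M"
    and deterministic: "action_deterministic M"
    and deadlock_free: "deadlock_free M"
    and progress: "maximal_progress M"
begin

abbreviation "s0 \<equiv> ma_init M"
abbreviation "bot_act \<equiv> ma_bot M"
abbreviation "u \<equiv> underlying_mdp M"

lemma underlying_mdp_simps [simp]:
  "mdp_prob u = ma_prob M" "mdp_init u = s0"
  by (simp_all add: underlying_mdp_def)

lemma not_PS_iff: "s \<notin> PS M \<longleftrightarrow> s \<in> MS M"
  using progress unfolding maximal_progress_def by blast

lemma exit_rate_pos:
  assumes "s \<notin> PS M" shows "0 < exit_rate M s"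
proof -
  from assms obtain r \<mu> where r: "(s, Inr r, \<mu>) \<in> ma_trans M"
    by (auto simp: not_PS_iff MS_def)
  then have "exit_rate M s = r" "0 < r"
    using automaton unfolding exit_rate_def markov_automaton_def by (blast intro!: the_equality)+
  then show ?thesis by simp
qed

text \<open>By maximal progress no state has both kinds of transitions, so \<open>bot_act\<close>
  cannot stand for an action and a Markovian transition at once. Within one kind, determinism or
  uniqueness of the Markovian transition decides.\<close>

lemma succ_dists_unique: "\<mu> \<in> succ_dists M s \<alpha> \<Longrightarrow> \<mu>' \<in> succ_dists M s \<alpha> \<Longrightarrow> \<mu> = \<mu>'"
  using automaton deterministic progress
  unfolding succ_dists_def markov_automaton_def action_deterministic_def maximal_progress_def PS_def MS_def
  by blast

lemma ma_prob_eq_pmf: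
  assumes "\<mu> \<in> succ_dists M s \<alpha>"
  shows "ma_prob M s \<alpha> = pmf \<mu>"
proof -
  have "(THE \<mu>. \<mu> \<in> succ_dists M s \<alpha>) = \<mu>"
    using assms by (rule the_equality) (rule succ_dists_unique[OF _ assms])
  with assms show ?thesis
    by (auto simp: ma_prob_def fun_eq_iff)
qed

lemma enabled_iff: "\<alpha> \<in> enabled (ma_prob M) s \<longleftrightarrow> succ_dists M s \<alpha> \<noteq> {}"
proof
  assume "succ_dists M s \<alpha> \<noteq> {}"
  then obtain \<mu> where "ma_prob M s \<alpha> = pmf \<mu>"
    using ma_prob_eq_pmf by blast
  moreover obtain s' where "s' \<in> set_pmf \<mu>"
    using set_pmf_not_empty by fast
  ultimately show "\<alpha> \<in> enabled (ma_prob M) s"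
    by (auto simp: enabled_def intro: pmf_positive)
qed (auto simp: enabled_def ma_prob_def)

text \<open>For an enabled action \<open>ma_prob\<close> is the mass function of a distribution,
  which \<open>embed_pmf\<close> recovers. For a disabled one it is identically zero, hence not a
  mass function.\<close>

lemma pmf_embed_ma_prob:
  assumes "\<alpha> \<in> enabled (ma_prob M) s"
  shows "pmf (embed_pmf (ma_prob M s \<alpha>)) s' = ma_prob M s \<alpha> s'"
proof -
  obtain \<mu> where "ma_prob M s \<alpha> = pmf \<mu>"
    using assms enabled_iff ma_prob_eq_pmf by blast
  then show ?thesis
    using type_definition.Rep_inverse[OF td_pmf_embed_pmf, of \<mu>] by simp
qed

lemma enabled_nonempty: "enabled (ma_prob M) s \<noteq> {}"
proof -
  obtain \<gamma> \<mu> where "(s, \<gamma>, \<mu>) \<in> ma_trans M"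
    using deadlock_free unfolding deadlock_free_def by blast
  then have "\<exists>\<alpha>. \<mu> \<in> succ_dists M s \<alpha>"
    by (cases \<gamma>) (auto simp: succ_dists_def)
  then show ?thesis
    using enabled_iff by blast
qed

lemma enabled_MS: "s \<notin> PS M \<Longrightarrow> enabled (ma_prob M) s = {bot_act}"
  using enabled_nonempty[of s] by (auto simp: enabled_iff succ_dists_def PS_def)

section \<open>The step kernels of the automaton and of the MDP\<close>

lemma sets_ma_kernel [simp]: "sets (ma_kernel M \<sigma> \<pi>) = sets step_space"
  by (simp add: ma_kernel_def Let_def)

lemma measurable_Inr_step:
  "(\<lambda>(t, s'). (Inr t, s')) \<in> measurable (density lborel f \<Otimes>\<^sub>M measure_pmf (p :: 's pmf)) step_space"
  unfolding step_space_def split_beta'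
  by (intro measurable_Pair measurable_compose[OF measurable_fst]
        measurable_compose[OF measurable_snd])
     (simp_all add: measurable_Inr_label_space cong: measurable_cong_sets)

lemma prob_space_ma_kernel: "prob_space (ma_kernel M \<sigma> \<pi>)"
proof (cases "last_state s0 \<pi> \<in> PS M")
  case True
  then show ?thesis
    by (simp add: ma_kernel_def measure_pmf.prob_space_distr)
next
  case False
  let ?D = "density lborel (exponential_density (exit_rate M (last_state s0 \<pi>)))"
  let ?p = "measure_pmf (embed_pmf (ma_prob M (last_state s0 \<pi>) bot_act))"
  interpret D: prob_space ?D
    by (rule prob_space_exponential_density[OF exit_rate_pos[OF False]])
  interpret D: pair_prob_space ?D ?p
    by unfold_locales
  show ?thesis
    using False D.prob_space_distr[OF measurable_Inr_step] by (simp add: ma_kernel_def Let_def)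
qed

lemma nn_integral_ma_kernel_PS:
  assumes "last_state s0 \<pi> \<in> PS M" and "h \<in> borel_measurable step_space"
  shows "(\<integral>\<^sup>+x. h x \<partial>ma_kernel M \<sigma> \<pi>) =
    (\<integral>\<^sup>+y. h (Inl (fst y), snd y) \<partial>measure_pmf (prob_step (ma_prob M) (last_state s0 \<pi>) (\<sigma> \<pi>)))"
  using assms by (simp add: ma_kernel_def nn_integral_distr split_beta')

text \<open>Fubini with the successor outside: the inner integral over time has an explicit
  exponential density, ready for the moment formulas.\<close>

lemma nn_integral_ma_kernel_MS:
  assumes PS: "last_state s0 \<pi> \<notin> PS M" and h: "h \<in> borel_measurable step_space"
  shows "(\<integral>\<^sup>+x. h x \<partial>ma_kernel M \<sigma> \<pi>) =
    (\<integral>\<^sup>+s'. \<integral>\<^sup>+t. ennreal (exponential_density (exit_rate M (last_state s0 \<pi>)) t) * h (Inr t, s') \<partial>lborel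
       \<partial>measure_pmf (embed_pmf (ma_prob M (last_state s0 \<pi>) bot_act)))"
proof -
  let ?D = "density lborel (exponential_density (exit_rate M (last_state s0 \<pi>)))"
  let ?p = "measure_pmf (embed_pmf (ma_prob M (last_state s0 \<pi>) bot_act))"
  interpret D: prob_space ?D
    by (rule prob_space_exponential_density[OF exit_rate_pos[OF PS]])
  interpret D: pair_prob_space ?D ?p
    by unfold_locales
  have h': "(\<lambda>x. h (Inr (fst x), snd x)) \<in> borel_measurable (?D \<Otimes>\<^sub>M ?p)"
    using measurable_compose[OF measurable_Inr_step h] by (simp add: split_beta')
  have h'': "(\<lambda>t. h (Inr t, s')) \<in> borel_measurable borel" for s'
    by (rule measurable_compose[OF _ h])
       (auto simp: step_space_def intro!: measurable_Pair measurable_Inr_label_space)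
  have "(\<integral>\<^sup>+x. h x \<partial>ma_kernel M \<sigma> \<pi>) = (\<integral>\<^sup>+x. h (Inr (fst x), snd x) \<partial>(?D \<Otimes>\<^sub>M ?p))"
    using PS by (simp add: ma_kernel_def Let_def nn_integral_distr[OF measurable_Inr_step] h) (simp add: split_beta')
  also have "\<dots> = (\<integral>\<^sup>+s'. \<integral>\<^sup>+t. h (Inr t, s') \<partial>?D \<partial>?p)"
    using D.nn_integral_snd[OF h'] by simp
  finally show ?thesis
    using h'' by (simp add: nn_integral_density)
qed

text \<open>The last state takes finitely many values, so it may be held fixed. In a probabilistic
  state the mass of a set is then a finite sum of scheduler probabilities with constant weights; in
  a Markovian state the kernel is constant.\<close>

lemma path_kernel_ma:
  assumes \<sigma>: "ma_scheduler M \<sigma>"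
  shows "path_kernel (ma_kernel M \<sigma>) step_space"
proof (rule path_kernel.intro)
  fix n
  let ?X = "PiM {0..<n} (\<lambda>_. step_space) :: (nat \<Rightarrow> ('a + real) \<times> 's) measure"
  define k where "k s \<omega> = (if s \<in> PS M
      then distr (measure_pmf (prob_step (ma_prob M) s (\<sigma> (prefix_path \<omega> n)))) step_space (\<lambda>(\<alpha>, s'). (Inl \<alpha>, s'))
      else distr (density lborel (exponential_density (exit_rate M s))
                    \<Otimes>\<^sub>M measure_pmf (embed_pmf (ma_prob M s bot_act)))
             step_space (\<lambda>(t, s'). (Inr t, s')))" for s \<omega>
  have "k s \<in> measurable ?X (subprob_algebra step_space)" for s
  proof (cases "s \<in> PS M")
    case True
    have pmf: "(\<lambda>\<omega>. pmf (\<sigma> (prefix_path \<omega> n)) \<alpha>) \<in> borel_measurable ?X" for \<alpha>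
      using \<sigma> by (simp add: ma_scheduler_def)
    have "(\<lambda>\<omega>. measure_pmf (prob_step (ma_prob M) s (\<sigma> (prefix_path \<omega> n)))) \<in>
        measurable ?X (subprob_algebra (count_space UNIV))"
    proof (rule measurable_subprob_algebra)
      fix A :: "('a \<times> 's) set"
      show "(\<lambda>\<omega>. emeasure (measure_pmf (prob_step (ma_prob M) s (\<sigma> (prefix_path \<omega> n)))) A) \<in> borel_measurable ?X"
        using pmf
        by (auto simp: emeasure_measure_pmf_finite pmf_prob_step split_beta'
              intro!: borel_measurable_sum measurable_compose[OF _ measurable_ennreal] borel_measurable_times)
    qed (auto simp: measure_pmf.subprob_space_axioms)
    then show ?thesis
      using True unfolding k_def
      by (simp, intro measurable_compose[OF _ measurable_distr]) auto
  next
    case False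
    \<comment> \<open>Any list ending in \<open>s\<close> serves as representative, because the
      kernel of a Markovian state reads only the last state.\<close>
    obtain \<pi> :: "(('a + real) \<times> 's) list" where "last_state s0 \<pi> = s"
      using last_state_snoc[of s0 "[]" "(undefined, s)"] by auto
    then have "k s \<omega> = ma_kernel M \<sigma> \<pi>" for \<omega>
      using False by (simp add: k_def ma_kernel_def)
    then show ?thesis
      using prob_space_ma_kernel[of \<sigma> \<pi>]
      by (simp add: space_subprob_algebra prob_space_imp_subprob_space cong: measurable_cong)
  qed
  moreover have "(\<lambda>\<omega>. last_state s0 (prefix_path \<omega> n)) \<in> measurable ?X (count_space UNIV)"
    using measurable_compose[OF measurable_map_prefix_path[OF measurable_erase, of n "{0..<n}" M],
        of "last_state s0" "count_space UNIV"]
    by (simp add: last_state_map)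
  ultimately have "(\<lambda>\<omega>. k (last_state s0 (prefix_path \<omega> n)) \<omega>) \<in> measurable ?X (subprob_algebra step_space)"
    by (rule measurable_compose_countable)
  also have "(\<lambda>\<omega>. k (last_state s0 (prefix_path \<omega> n)) \<omega>) = (\<lambda>\<omega>. ma_kernel M \<sigma> (prefix_path \<omega> n))"
    by (simp add: k_def ma_kernel_def Let_def fun_eq_iff)
  finally show "(\<lambda>\<omega>. ma_kernel M \<sigma> (prefix_path \<omega> n)) \<in> measurable ?X (subprob_algebra step_space)" .
qed (rule prob_space_ma_kernel)

lemma path_kernel_mdp: "path_kernel (mdp_kernel u \<sigma>) (count_space UNIV)"
proof (rule path_kernel.intro)
  fix n
  have "(\<lambda>w. mdp_kernel u \<sigma> w) \<in> measurable (count_space UNIV) (subprob_algebra (count_space UNIV))"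
    unfolding mdp_kernel_def by (rule measurable_measure_pmf)
  then show "(\<lambda>\<omega>. mdp_kernel u \<sigma> (prefix_path \<omega> n)) \<in>
      measurable (PiM {0..<n} (\<lambda>_. count_space UNIV)) (subprob_algebra (count_space UNIV))"
    using measurable_compose[OF measurable_map_prefix_path[of id "count_space UNIV" n "{0..<n}"]] by simp
qed (auto simp: mdp_kernel_def measure_pmf.prob_space_axioms)

section \<open>Probabilities of finite paths of the MDP\<close>

definition mdp_path_prob :: "(('a \<times> 's) list \<Rightarrow> 'a pmf) \<Rightarrow> ('a \<times> 's) list \<Rightarrow> ennreal" where
  "mdp_path_prob \<tau> w = (\<integral>\<^sup>+\<omega>. of_bool (prefix_path \<omega> (length w) = w) \<partial>mdp_measure u \<tau>)"

lemma sets_mdp_measure: "sets (mdp_measure u \<tau>) = sets (PiM UNIV (\<lambda>_. count_space UNIV))"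
  unfolding mdp_measure_def by (rule path_kernel.sets_path_measure[OF path_kernel_mdp])

lemma space_mdp_measure [simp]: "space (mdp_measure u \<tau>) = UNIV"
  using sets_eq_imp_space_eq[OF sets_mdp_measure] by (auto simp: space_PiM)

lemma prob_space_mdp_measure: "prob_space (mdp_measure u \<tau>)"
  unfolding mdp_measure_def by (rule path_kernel.prob_space_path_measure[OF path_kernel_mdp])

lemma sets_cylinder:
  "{\<omega> :: nat \<Rightarrow> 'a \<times> 's. prefix_path \<omega> n = w} \<in> sets (PiM UNIV (\<lambda>_. count_space UNIV))"
  using measurable_sets[OF measurable_map_prefix_path[of id "count_space UNIV" n UNIV], of "{w}"]
  by (simp add: vimage_def space_PiM)

lemma emeasure_mdp_cylinder:
  "emeasure (mdp_measure u \<tau>) {\<omega>. prefix_path \<omega> (length w) = w} = mdp_path_prob \<tau> w"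
proof -
  have "emeasure (mdp_measure u \<tau>) {\<omega>. prefix_path \<omega> (length w) = w} =
      (\<integral>\<^sup>+\<omega>. indicator {\<omega>. prefix_path \<omega> (length w) = w} \<omega> \<partial>mdp_measure u \<tau>)"
    using sets_cylinder by (simp add: sets_mdp_measure)
  then show ?thesis
    by (simp add: mdp_path_prob_def indicator_def of_bool_def)
qed

lemma mdp_path_prob_Nil: "mdp_path_prob \<tau> [] = 1"
  using prob_space.emeasure_space_1[OF prob_space_mdp_measure] by (simp add: mdp_path_prob_def)

text \<open>With the value 1 at the empty path this is the product formula for path probabilities.
  It is obtained by integrating out the last step, with \<open>H\<close> testing both the past and
  that step.\<close>

lemma mdp_path_prob_snoc:
  "mdp_path_prob \<tau> (w @ [(\<alpha>, s')]) = mdp_path_prob \<tau> w * ennreal (pmf (\<tau> w) \<alpha>) *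
      ennreal (pmf (embed_pmf (ma_prob M (last_state s0 w) \<alpha>)) s')"
proof -
  interpret path_kernel "mdp_kernel u \<tau>" "count_space UNIV"
    by (rule path_kernel_mdp)
  define H :: "('a \<times> 's) list \<Rightarrow> 'a \<times> 's \<Rightarrow> ennreal" where
    "H v x = of_bool (v = w) * indicator {(\<alpha>, s')} x" for v x
  let ?c = "ennreal (pmf (\<tau> w) \<alpha>) * ennreal (pmf (embed_pmf (ma_prob M (last_state s0 w) \<alpha>)) s')"
  have kernel: "(\<integral>\<^sup>+x. H v x \<partial>mdp_kernel u \<tau> v) = of_bool (v = w) * ?c" for v
    unfolding H_def mdp_kernel_def
    by (subst nn_integral_cmult) (auto simp: emeasure_pmf_single pmf_prob_step ennreal_mult)
  have "mdp_path_prob \<tau> (w @ [(\<alpha>, s')]) =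
      (\<integral>\<^sup>+\<omega>. H (map id (prefix_path \<omega> (length w))) (\<omega> (length w)) \<partial>mdp_measure u \<tau>)"
    unfolding mdp_path_prob_def
    by (rule nn_integral_cong) (simp add: H_def prefix_path_Suc indicator_def)
  also have "\<dots> = (\<integral>\<^sup>+\<omega>. of_bool (prefix_path \<omega> (length w) = w) * ?c \<partial>mdp_measure u \<tau>)"
    unfolding mdp_measure_def
    by (subst nn_integral_step[where H=H]) (simp_all add: kernel)
  also have "\<dots> = mdp_path_prob \<tau> w * ?c"
    unfolding mdp_path_prob_def
  proof (rule nn_integral_multc)
    have "(\<lambda>\<omega>. indicator {\<omega>. prefix_path \<omega> (length w) = w} \<omega> :: ennreal) \<in> borel_measurable (mdp_measure u \<tau>)"
      using sets_cylinder by (intro borel_measurable_indicator) (simp add: sets_mdp_measure)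
    then show "(\<lambda>\<omega>. of_bool (prefix_path \<omega> (length w) = w) :: ennreal) \<in> borel_measurable (mdp_measure u \<tau>)"
      by (simp add: indicator_def of_bool_def)
  qed
  finally show ?thesis
    by (simp add: mult.assoc)
qed

text \<open>At the first step that leaves the paths, either the action is disabled and the scheduler
  gives it probability 0, or the successor has probability 0. The zero factor then persists.\<close>

lemma mdp_path_prob_eq_0:
  assumes "mdp_scheduler u \<tau>"
  shows "w \<notin> mdp_paths u \<Longrightarrow> mdp_path_prob \<tau> w = 0"
proof (induction w rule: rev_induct)
  case (snoc y w)
  obtain \<alpha> s' where y: "y = (\<alpha>, s')"
    by fastforce
  show ?case
  proof (cases "w \<in> mdp_paths u")
    case True
    then have "\<not> 0 < ma_prob M (last_state s0 w) \<alpha> s'"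
      using snoc.prems by (simp add: y mdp_paths_def is_path_snoc)
    moreover have "set_pmf (\<tau> w) \<subseteq> enabled (ma_prob M) (last_state s0 w)"
      using True assms by (simp add: mdp_scheduler_def)
    ultimately have "pmf (\<tau> w) \<alpha> = 0 \<or> pmf (embed_pmf (ma_prob M (last_state s0 w) \<alpha>)) s' = 0"
      using pmf_embed_ma_prob[of \<alpha> "last_state s0 w" s']
        pmf_nonneg[of "embed_pmf (ma_prob M (last_state s0 w) \<alpha>)" s']
      by (metis antisym_conv2 pmf_eq_0_set_pmf subsetD)
    then show ?thesis
      by (auto simp: y mdp_path_prob_snoc)
  qed (use snoc.IH in \<open>simp add: y mdp_path_prob_snoc\<close>)
qed (simp add: mdp_paths_def)

end

section \<open>Erasing sojourn times\<close>

locale scheduled_ma = valid_ma M for M :: "('s::finite, 'a::finite) ma" +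
  fixes \<sigma> :: "(('a + real) \<times> 's) list \<Rightarrow> 'a pmf"
  assumes scheduler: "ma_scheduler M \<sigma>"
begin

sublocale pk: path_kernel "ma_kernel M \<sigma>" step_space
  by (rule path_kernel_ma[OF scheduler])

abbreviation "Pr \<equiv> ma_measure M \<sigma>"

lemma sets_Pr [measurable_cong]: "sets Pr = sets (PiM UNIV (\<lambda>_. step_space))"
  by (simp add: ma_measure_def)

lemma space_Pr [simp]: "space Pr = UNIV"
  by (simp add: ma_measure_def pk.space_path_measure space_PiM)

lemma prob_space_Pr: "prob_space Pr"
  by (simp add: ma_measure_def pk.prob_space_path_measure)

abbreviation erased_prefix :: "(nat \<Rightarrow> ('a + real) \<times> 's) \<Rightarrow> nat \<Rightarrow> ('a \<times> 's) list" where
  "erased_prefix \<omega> n \<equiv> map (erase M) (prefix_path \<omega> n)"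

lemma last_state_erase [simp]: "last_state s (map (erase M) \<pi>) = last_state s \<pi>"
  by (simp add: last_state_map)

lemma nn_integral_Pr_step:
  assumes "\<And>w. H w \<in> borel_measurable step_space"
  shows "(\<integral>\<^sup>+\<omega>. H (erased_prefix \<omega> n) (\<omega> n) \<partial>Pr) =
    (\<integral>\<^sup>+\<omega>. (\<integral>\<^sup>+x. H (erased_prefix \<omega> n) x \<partial>ma_kernel M \<sigma> (prefix_path \<omega> n)) \<partial>Pr)"
  unfolding ma_measure_def by (rule pk.nn_integral_step[OF measurable_erase assms])

lemma measurable_Pr_step:
  assumes "\<And>w. H w \<in> borel_measurable step_space"
  shows "(\<lambda>\<omega>. H (erased_prefix \<omega> n) (\<omega> n)) \<in> borel_measurable Pr"
  using measurable_prefix_path_step[OF measurable_erase assms, of n UNIV]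
  by (simp add: sets_Pr cong: measurable_cong_sets)

lemma measurable_erased_prefix: "(\<lambda>\<omega>. erased_prefix \<omega> n) \<in> measurable Pr (count_space UNIV)"
  using measurable_map_prefix_path[OF measurable_erase, of n UNIV M]
  by (simp add: sets_Pr cong: measurable_cong_sets)

lemma borel_measurable_erase: "(\<lambda>x. g (erase M x)) \<in> borel_measurable step_space"
  by (rule measurable_compose[OF measurable_erase]) simp

text \<open>The part of \<open>ma_step\<close> that concerns labels and is lost by erasure;
  positivity of the transition probability is visible on the erased path.\<close>

definition label_ok :: "'s \<Rightarrow> 'a + real \<Rightarrow> bool" where
  "label_ok s \<kappa> \<longleftrightarrow> (case \<kappa> of Inl \<alpha> \<Rightarrow> s \<in> PS M | Inr t \<Rightarrow> s \<notin> PS M \<and> 0 \<le> t)"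

text \<open>The kernel gives a violation mass 0: in a probabilistic state it emits actions only, and
  in a Markovian state the density vanishes at negative times. Countably many null sets are then
  combined.\<close>

lemma AE_label_ok: "AE \<omega> in Pr. \<forall>n. label_ok (last_state s0 (prefix_path \<omega> n)) (fst (\<omega> n))"
  unfolding AE_all_countable
proof
  fix n
  define H :: "('a \<times> 's) list \<Rightarrow> ('a + real) \<times> 's \<Rightarrow> ennreal" where
    "H w x = (if label_ok (last_state s0 w) (fst x) then 0 else 1)" for w x
  have H: "H w \<in> borel_measurable step_space" for w
    unfolding H_def label_ok_def by (rule measurable_step_spaceI) simp_all
  have "(\<integral>\<^sup>+x. H (map (erase M) \<pi>) x \<partial>ma_kernel M \<sigma> \<pi>) = 0" for \<pi>
  proof (cases "last_state s0 \<pi> \<in> PS M")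
    case True
    then show ?thesis
      by (simp add: nn_integral_ma_kernel_PS[OF _ H]) (simp add: H_def label_ok_def)
  next
    case False
    then have "ennreal (exponential_density (exit_rate M (last_state s0 \<pi>)) t) * H (map (erase M) \<pi>) (Inr t, s') = 0" for t s'
      by (simp add: H_def label_ok_def exponential_density_def)
    then show ?thesis
      unfolding nn_integral_ma_kernel_MS[OF False H] by (simp only: nn_integral_const mult_zero_left)
  qed
  then have "(\<integral>\<^sup>+\<omega>. H (erased_prefix \<omega> n) (\<omega> n) \<partial>Pr) = 0"
    unfolding nn_integral_Pr_step[where H=H, OF H] by (simp only: nn_integral_const mult_zero_left)
  then have "AE \<omega> in Pr. H (erased_prefix \<omega> n) (\<omega> n) = 0"
    using measurable_Pr_step[where H=H, OF H] by (simp add: nn_integral_0_iff_AE)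
  then show "AE \<omega> in Pr. label_ok (last_state s0 (prefix_path \<omega> n)) (fst (\<omega> n))"
    by eventually_elim (simp add: H_def split: if_splits)
qed

text \<open>Needed to apply the constraint on the scheduler, which is imposed on paths of the
  automaton only. The labels are right by \<open>label_ok\<close>, and the transition probabilities
  are positive along the erased path.\<close>

lemma prefix_path_in_ma_paths:
  assumes "\<And>n. label_ok (last_state s0 (prefix_path \<omega> n)) (fst (\<omega> n))"
    and "erased_prefix \<omega> n \<in> mdp_paths u"
  shows "prefix_path \<omega> n \<in> ma_paths M"
  using assms(2)
proof (induction n)
  case (Suc n)
  obtain \<kappa> s' where [simp]: "\<omega> n = (\<kappa>, s')"
    by fastforce
  from Suc show ?case
    using assms(1)[of n]
    by (cases \<kappa>)
       (auto simp: prefix_path_Suc mdp_paths_def ma_paths_def is_path_snoc ma_step_def label_ok_def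
          not_PS_iff)
qed (simp add: ma_paths_def)

text \<open>In a Markovian state the kernel ignores the scheduler and behaves as if \<open>bot_act\<close> were chosen;
  off the paths the scheduler need not agree with this.\<close>

definition choice :: "(('a + real) \<times> 's) list \<Rightarrow> 'a pmf" where
  "choice \<pi> = (if last_state s0 \<pi> \<in> PS M then \<sigma> \<pi> else return_pmf bot_act)"

text \<open>After erasure a step of the automaton is an MDP step under \<open>choice\<close>: in a
  Markovian state the time integrates out because the density has mass 1.\<close>

lemma nn_integral_ma_kernel_erase:
  "(\<integral>\<^sup>+x. g (erase M x) \<partial>ma_kernel M \<sigma> \<pi>) =
    (\<integral>\<^sup>+y. g y \<partial>measure_pmf (prob_step (ma_prob M) (last_state s0 \<pi>) (choice \<pi>)))"
proof (cases "last_state s0 \<pi> \<in> PS M")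
  case True
  then show ?thesis
    by (simp add: nn_integral_ma_kernel_PS[OF _ borel_measurable_erase] choice_def)
next
  case False
  then show ?thesis
    by (simp add: nn_integral_exponential_const exit_rate_pos nn_integral_ma_kernel_MS[OF _ borel_measurable_erase] choice_def prob_step_def
        bind_return_pmf)
qed

lemma measurable_choice:
  "(\<lambda>\<omega>. of_bool (erased_prefix \<omega> n = w) * ennreal (pmf (choice (prefix_path \<omega> n)) \<alpha>)) \<in> borel_measurable Pr"
proof -
  have res: "(\<lambda>\<omega>. restrict \<omega> {0..<n}) \<in> measurable Pr (PiM {0..<n} (\<lambda>_. step_space))"
    using measurable_restrict_subset[of "{0..<n}" UNIV "\<lambda>_. step_space"]
    by (simp add: sets_Pr cong: measurable_cong_sets)
  have pmf: "(\<lambda>\<omega>. pmf (\<sigma> (prefix_path \<omega> n)) \<alpha>) \<in> borel_measurable (PiM {0..<n} (\<lambda>_. step_space))"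
    using scheduler by (simp add: ma_scheduler_def)
  have "(\<lambda>\<omega>. pmf (\<sigma> (prefix_path \<omega> n)) \<alpha>) \<in> borel_measurable Pr"
    using measurable_compose[OF res pmf] by simp
  \<comment> \<open>Fixing the erased prefix as \<open>v\<close> settles the case distinction of
    \<open>choice\<close>, which reads only the last state.\<close>
  then have *: "(\<lambda>\<omega>. pmf (if last_state s0 v \<in> PS M then \<sigma> (prefix_path \<omega> n) else return_pmf bot_act) \<alpha>) \<in> borel_measurable Pr"
    for v :: "('a \<times> 's) list"
    by (cases "last_state s0 v \<in> PS M") simp_all
  have "(\<lambda>\<omega>. of_bool (erased_prefix \<omega> n = w) *
      ennreal (pmf (if last_state s0 (erased_prefix \<omega> n) \<in> PS M then \<sigma> (prefix_path \<omega> n) else return_pmf bot_act) \<alpha>))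
      \<in> borel_measurable Pr"
    using * by (intro measurable_compose_countable[OF _ measurable_erased_prefix[of n], where f="\<lambda>v \<omega>.
        of_bool (v = w) * ennreal (pmf (if last_state s0 v \<in> PS M then \<sigma> (prefix_path \<omega> n) else return_pmf bot_act) \<alpha>)"])
      (auto intro!: borel_measurable_times_ennreal measurable_compose[OF _ measurable_ennreal])
  then show ?thesis
    by (simp add: choice_def)
qed

section \<open>Probabilities of erased prefixes\<close>

definition path_prob :: "('a \<times> 's) list \<Rightarrow> ennreal" where
  "path_prob w = (\<integral>\<^sup>+\<omega>. of_bool (erased_prefix \<omega> (length w) = w) \<partial>Pr)"

text \<open>The joint probability of the erased prefix \<open>w\<close> and the next action, left
  undivided so that it makes sense when \<open>w\<close> is null.\<close>

definition choice_prob :: "('a \<times> 's) list \<Rightarrow> 'a \<Rightarrow> ennreal" where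
  "choice_prob w \<alpha> = (\<integral>\<^sup>+\<omega>. of_bool (erased_prefix \<omega> (length w) = w) * ennreal (pmf (choice (prefix_path \<omega> (length w))) \<alpha>) \<partial>Pr)"

lemma path_prob_Nil: "path_prob [] = 1"
  using prob_space.emeasure_space_1[OF prob_space_Pr] by (simp add: path_prob_def)

text \<open>The past sojourn times influence the next erased step only through
  \<open>choice\<close>; the successor probability is constant once \<open>w\<close> and
  \<open>\<alpha>\<close> are known and leaves the integral.\<close>

lemma path_prob_snoc:
  "path_prob (w @ [(\<alpha>, s')]) =
    choice_prob w \<alpha> *
      ennreal (pmf (embed_pmf (ma_prob M (last_state s0 w) \<alpha>)) s')"
proof -
  define H :: "('a \<times> 's) list \<Rightarrow> ('a + real) \<times> 's \<Rightarrow> ennreal" where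
    "H v x = of_bool (v = w) * of_bool (erase M x = (\<alpha>, s'))" for v x
  have H: "H v \<in> borel_measurable step_space" for v
    unfolding H_def by (rule borel_measurable_erase)
  have kernel: "(\<integral>\<^sup>+x. H v x \<partial>ma_kernel M \<sigma> \<pi>) =
      of_bool (v = w) * ennreal (pmf (prob_step (ma_prob M) (last_state s0 \<pi>) (choice \<pi>)) (\<alpha>, s'))" for v \<pi>
  proof -
    have "(\<integral>\<^sup>+x. H v x \<partial>ma_kernel M \<sigma> \<pi>) = (\<integral>\<^sup>+y. of_bool (v = w) * indicator {(\<alpha>, s')} y
        \<partial>measure_pmf (prob_step (ma_prob M) (last_state s0 \<pi>) (choice \<pi>)))"
      unfolding H_def
      by (subst nn_integral_ma_kernel_erase) (simp add: indicator_def of_bool_def)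
    also have "\<dots> = of_bool (v = w) * emeasure (measure_pmf (prob_step (ma_prob M) (last_state s0 \<pi>) (choice \<pi>))) {(\<alpha>, s')}"
      by (subst nn_integral_cmult) simp_all
    finally show ?thesis
      by (simp add: emeasure_pmf_single)
  qed
  have "path_prob (w @ [(\<alpha>, s')]) = (\<integral>\<^sup>+\<omega>. H (erased_prefix \<omega> (length w)) (\<omega> (length w)) \<partial>Pr)"
    unfolding path_prob_def
    by (rule nn_integral_cong) (simp add: H_def prefix_path_Suc)
  also have "\<dots> = (\<integral>\<^sup>+\<omega>. of_bool (erased_prefix \<omega> (length w) = w) *
      ennreal (pmf (choice (prefix_path \<omega> (length w))) \<alpha>) *
      ennreal (pmf (embed_pmf (ma_prob M (last_state s0 w) \<alpha>)) s') \<partial>Pr)"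
    unfolding nn_integral_Pr_step[where H=H, OF H] kernel
  proof (rule nn_integral_cong)
    fix \<omega>
    \<comment> \<open>Where the erased prefix differs from \<open>w\<close> both integrands are 0;
      elsewhere the last states agree.\<close>
    have "last_state s0 (prefix_path \<omega> (length w)) = last_state s0 w" if "erased_prefix \<omega> (length w) = w"
      by (metis last_state_erase that)
    then show "of_bool (erased_prefix \<omega> (length w) = w) *
        ennreal (pmf (prob_step (ma_prob M) (last_state s0 (prefix_path \<omega> (length w)))
          (choice (prefix_path \<omega> (length w)))) (\<alpha>, s')) =
      of_bool (erased_prefix \<omega> (length w) = w) *
      ennreal (pmf (choice (prefix_path \<omega> (length w))) \<alpha>) *
      ennreal (pmf (embed_pmf (ma_prob M (last_state s0 w) \<alpha>)) s')"
      by (auto simp: pmf_prob_step ennreal_mult)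
  qed
  finally show ?thesis
    using measurable_choice by (simp add: nn_integral_multc choice_prob_def)
qed

lemma emeasure_erased_prefix: "emeasure Pr {\<omega>. erased_prefix \<omega> (length w) = w} = path_prob w"
proof -
  have "{\<omega>. erased_prefix \<omega> (length w) = w} \<in> sets Pr"
    using measurable_sets[OF measurable_erased_prefix, of "{w}"] by (simp add: vimage_def)
  then have "emeasure Pr {\<omega>. erased_prefix \<omega> (length w) = w} =
      (\<integral>\<^sup>+\<omega>. indicator {\<omega>. erased_prefix \<omega> (length w) = w} \<omega> \<partial>Pr)"
    by simp
  then show ?thesis
    by (simp add: path_prob_def indicator_def of_bool_def)
qed

lemma nn_integral_step_reward:
  fixes j :: nat and \<pi> :: "(('a + real) \<times> 's) list"
  defines "s \<equiv> last_state s0 \<pi>"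
  assumes "j < length (ma_rewards M)"
  shows "(\<integral>\<^sup>+x. ennreal (ma_step_reward M j s (fst x)) \<partial>ma_kernel M \<sigma> \<pi>) =
    (\<integral>\<^sup>+x. ennreal (underlying_reward M (ma_rewards M ! j) (s, fst (erase M x))) \<partial>ma_kernel M \<sigma> \<pi>)"
proof -
  have nonneg: "0 \<le> (ma_rewards M ! j) x" for x
    using automaton assms(2) by (auto simp: markov_automaton_def)
  have m: "(\<lambda>x :: ('a + real) \<times> 's. ennreal (ma_step_reward M j s (fst x))) \<in> borel_measurable step_space"
    by (rule measurable_step_spaceI) (simp_all add: ma_step_reward_def)
  have m': "(\<lambda>x. ennreal (underlying_reward M (ma_rewards M ! j) (s, fst (erase M x)))) \<in> borel_measurable step_space"
    by (rule borel_measurable_erase)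
  show ?thesis
  proof (cases "s \<in> PS M")
    case True
    then have PS: "last_state s0 \<pi> \<in> PS M"
      by (simp add: s_def)
    show ?thesis
      using True
      by (simp add: nn_integral_ma_kernel_PS[OF PS m] nn_integral_ma_kernel_PS[OF PS m'])
         (simp add: ma_step_reward_def underlying_reward_def)
  next
    case False
    then have PS: "last_state s0 \<pi> \<notin> PS M"
      by (simp add: s_def)
    have "underlying_reward M (ma_rewards M ! j) (s, bot_act) =
        (ma_rewards M ! j) (Inl s) / exit_rate M s + (ma_rewards M ! j) (Inr (s, bot_act))"
      using False by (simp add: underlying_reward_def flip: not_PS_iff)
    then show ?thesis
      unfolding nn_integral_ma_kernel_MS[OF PS m] nn_integral_ma_kernel_MS[OF PS m'] s_def[symmetric]
      by (simp add: ma_step_reward_def nn_integral_exponential_const nn_integral_exponential_affine nonneg exit_rate_pos[OF False])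
  qed
qed

section \<open>The erased process as a run of the MDP\<close>

lemma measurable_erase_seq:
  "(\<lambda>\<omega> i. erase M (\<omega> i)) \<in> measurable Pr (PiM UNIV (\<lambda>_. count_space UNIV))"
proof (rule measurable_PiM_single')
  fix i :: nat
  have "(\<lambda>\<omega>. \<omega> i) \<in> measurable Pr step_space"
    using measurable_component_singleton[of i UNIV "\<lambda>_. step_space"]
    by (simp add: sets_Pr cong: measurable_cong_sets)
  then show "(\<lambda>\<omega>. erase M (\<omega> i)) \<in> measurable Pr (count_space UNIV)"
    by (rule measurable_compose[OF _ measurable_erase])
qed simp

text \<open>Both measures are determined by their prefix cylinders. Under \<open>cond\<close> the
  masses of these satisfy the same recursion along the list.\<close>

lemma distr_erase_eq_mdp_measure:
  assumes \<tau>: "mdp_scheduler u \<tau>"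
    and cond: "\<And>w \<alpha>. w \<in> mdp_paths u \<Longrightarrow>
      choice_prob w \<alpha> =
      path_prob w * ennreal (pmf (\<tau> w) \<alpha>)"
  shows "distr Pr (PiM UNIV (\<lambda>_. count_space UNIV)) (\<lambda>\<omega> i. erase M (\<omega> i)) = mdp_measure u \<tau>"
proof (rule path_measure_eqI)
  show "prob_space (distr Pr (PiM UNIV (\<lambda>_. count_space UNIV)) (\<lambda>\<omega> i. erase M (\<omega> i)))"
    by (rule prob_space.prob_space_distr[OF prob_space_Pr measurable_erase_seq])
  have eq: "path_prob w = mdp_path_prob \<tau> w" for w
  proof (induction w rule: rev_induct)
    case (snoc y w)
    obtain \<alpha> s' where y: "y = (\<alpha>, s')"
      by fastforce
    show ?case
    proof (cases "w \<in> mdp_paths u")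
      case True
      then show ?thesis
        by (simp add: y path_prob_snoc mdp_path_prob_snoc cond snoc.IH)
    next
      case False
      then have "mdp_path_prob \<tau> w = 0"
        by (rule mdp_path_prob_eq_0[OF \<tau>])
      moreover have "choice_prob w \<alpha> \<le> path_prob w"
        unfolding choice_prob_def path_prob_def by (rule nn_integral_mono) (auto simp: pmf_le_1)
      ultimately show ?thesis
        using snoc.IH by (simp add: y path_prob_snoc mdp_path_prob_snoc)
    qed
  qed (simp add: path_prob_Nil mdp_path_prob_Nil)
  fix n and w :: "('a \<times> 's) list"
  show "emeasure (distr Pr (PiM UNIV (\<lambda>_. count_space UNIV)) (\<lambda>\<omega> i. erase M (\<omega> i))) {\<omega>. prefix_path \<omega> n = w} =
      emeasure (mdp_measure u \<tau>) {\<omega>. prefix_path \<omega> n = w}"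
  proof (cases "n = length w")
    case True
    then show ?thesis
      using emeasure_erased_prefix[of w]
      by (simp add: emeasure_distr[OF measurable_erase_seq sets_cylinder] vimage_def prefix_path_comp
          emeasure_mdp_cylinder eq)
  next
    case False
    then have "{\<omega> :: nat \<Rightarrow> 'a \<times> 's. prefix_path \<omega> n = w} = {}"
      by auto
    then show ?thesis
      by (simp only: emeasure_empty)
  qed
qed (simp_all add: sets_mdp_measure)

text \<open>The reachability event is the preimage of its MDP counterpart under erasure. The
  accumulated reward is not a function of the erased path, but it is a series of nonnegative terms,
  and each term can be replaced inside the expectation after conditioning on the past.\<close>

lemma value_eq:
  assumes distr: "distr Pr (PiM UNIV (\<lambda>_. count_space UNIV)) (\<lambda>\<omega> i. erase M (\<omega> i)) = mdp_measure u \<tau>"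
    and ok: "objective_ok (length (ma_rewards M)) Ob"
  shows "ma_value M \<sigma> Ob = mdp_value u \<tau> Ob"
proof (cases Ob)
  case (Reach G)
  have m: "(\<lambda>\<omega>. state_at s0 \<omega> n) \<in> measurable (PiM UNIV (\<lambda>_. count_space (UNIV :: ('a \<times> 's) set))) (count_space UNIV)" for n
    using measurable_compose[OF measurable_map_prefix_path[of id "count_space UNIV" n UNIV],
        of "last_state s0" "count_space UNIV"]
    by (simp add: state_at_eq_last_state)
  have "{\<omega> :: nat \<Rightarrow> 'a \<times> 's. \<exists>n. state_at s0 \<omega> n \<in> G} =
      (\<Union>n. (\<lambda>\<omega>. state_at s0 \<omega> n) -` G \<inter> space (PiM UNIV (\<lambda>_. count_space UNIV)))"
    by (auto simp: space_PiM)
  also have "\<dots> \<in> sets (PiM UNIV (\<lambda>_. count_space UNIV))"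
    using measurable_sets[OF m, of G] by (intro sets.countable_UN) auto
  finally have "measure (mdp_measure u \<tau>) {\<omega>. \<exists>n. state_at s0 \<omega> n \<in> G} =
      measure Pr {\<omega>. \<exists>n. state_at s0 \<omega> n \<in> G}"
    unfolding distr[symmetric]
    by (subst measure_distr[OF measurable_erase_seq]) (simp_all add: vimage_def state_at_comp)
  then show ?thesis
    by (simp add: Reach ma_value_def mdp_value_def)
next
  case (Exp_Reward j G)
  with ok have j: "j < length (ma_rewards M)"
    by simp
  have nonneg: "0 \<le> (ma_rewards M ! j) x" for x
    using automaton j by (auto simp: markov_automaton_def)
  define \<rho> where "\<rho> = underlying_reward M (ma_rewards M ! j)"
  have \<rho>: "mdp_rewards u ! j = \<rho>"
    using j by (simp add: underlying_mdp_def \<rho>_def)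
  have \<rho>_nonneg: "0 \<le> \<rho> x" for x
    using nonneg exit_rate_pos
    by (auto simp: \<rho>_def underlying_reward_def not_PS_iff less_imp_le split: prod.split)
  define H where "H w x = of_bool (avoids s0 G w) * ennreal (ma_step_reward M j (last_state s0 w) (fst x))"
    for w :: "('a \<times> 's) list" and x :: "('a + real) \<times> 's"
  define H' where "H' w y = of_bool (avoids s0 G w) * ennreal (\<rho> (last_state s0 w, fst y))"
    for w :: "('a \<times> 's) list" and y :: "'a \<times> 's"
  have step_m: "(\<lambda>x :: ('a + real) \<times> 's. ennreal (ma_step_reward M j s (fst x))) \<in> borel_measurable step_space" for s
    by (rule measurable_step_spaceI) (simp_all add: ma_step_reward_def)
  have H: "H w \<in> borel_measurable step_space" for w
    unfolding H_def by (intro borel_measurable_times_ennreal step_m) simp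
  have H'_erase: "(\<lambda>x. H' w (erase M x)) \<in> borel_measurable step_space" for w
    by (rule borel_measurable_erase)
  have kernel: "(\<integral>\<^sup>+x. H (map (erase M) \<pi>) x \<partial>ma_kernel M \<sigma> \<pi>) =
      (\<integral>\<^sup>+x. H' (map (erase M) \<pi>) (erase M x) \<partial>ma_kernel M \<sigma> \<pi>)" for \<pi>
  proof -
    have *: "f \<in> borel_measurable step_space \<Longrightarrow> f \<in> borel_measurable (ma_kernel M \<sigma> \<pi>)"
      for f :: "('a + real) \<times> 's \<Rightarrow> ennreal"
      by (simp cong: measurable_cong_sets)
    show ?thesis
      unfolding H_def H'_def \<rho>_def last_state_erase
      using nn_integral_step_reward[OF j, of \<pi>]
      by (simp add: nn_integral_cmult * step_m borel_measurable_erase[where g="\<lambda>y. ennreal (f (fst y))" for f])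
  qed
  have H'_m: "(\<lambda>\<omega>. H' (prefix_path \<omega> n) (\<omega> n)) \<in> borel_measurable (PiM UNIV (\<lambda>_. count_space UNIV))" for n
    using measurable_prefix_path_step[of id "count_space UNIV" H' n UNIV] by simp
  have "(\<integral>\<^sup>+\<omega>. reward_upto s0 (ma_step_reward M j) G \<omega> \<partial>Pr) =
      (\<integral>\<^sup>+\<omega>. (\<Sum>n. H (erased_prefix \<omega> n) (\<omega> n)) \<partial>Pr)"
  proof (rule nn_integral_cong_AE)
    \<comment> \<open>The series expansion needs nonnegative step rewards, and sojourn times are
      nonnegative only almost surely.\<close>
    show "AE \<omega> in Pr. reward_upto s0 (ma_step_reward M j) G \<omega> = (\<Sum>n. H (erased_prefix \<omega> n) (\<omega> n))"
      using AE_label_ok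
    proof eventually_elim
      case (elim \<omega>)
      have "0 \<le> label_time (fst (\<omega> n))" for n
        using elim[rule_format, of n] by (cases "fst (\<omega> n)") (auto simp: label_ok_def)
      then have "0 \<le> ma_step_reward M j (state_at s0 \<omega> n) (fst (\<omega> n))" for n
        by (simp add: ma_step_reward_def nonneg)
      then show ?case
        by (simp add: reward_upto_eq_suminf H_def avoids_map)
    qed
  qed
  also have "\<dots> = (\<Sum>n. \<integral>\<^sup>+\<omega>. H (erased_prefix \<omega> n) (\<omega> n) \<partial>Pr)"
    by (rule nn_integral_suminf) (rule measurable_Pr_step[where H=H, OF H])
  \<comment> \<open>Both sides become iterated integrals over past and kernel, where
    \<open>kernel\<close> exchanges the timed reward for its mean.\<close>
  also have "\<dots> = (\<Sum>n. \<integral>\<^sup>+\<omega>. H' (erased_prefix \<omega> n) (erase M (\<omega> n)) \<partial>Pr)"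
    unfolding nn_integral_Pr_step[where H=H, OF H] kernel
    by (subst nn_integral_Pr_step[where H="\<lambda>w x. H' w (erase M x)", OF H'_erase]) simp
  also have "\<dots> = (\<Sum>n. \<integral>\<^sup>+\<omega>. H' (prefix_path \<omega> n) (\<omega> n) \<partial>mdp_measure u \<tau>)"
    unfolding distr[symmetric]
    by (subst nn_integral_distr[OF measurable_erase_seq]) (simp_all add: H'_m prefix_path_comp)
  also have "\<dots> = (\<integral>\<^sup>+\<omega>. (\<Sum>n. H' (prefix_path \<omega> n) (\<omega> n)) \<partial>mdp_measure u \<tau>)"
    using H'_m by (intro nn_integral_suminf[symmetric]) (simp add: sets_mdp_measure cong: measurable_cong_sets)
  also have "\<dots> = (\<integral>\<^sup>+\<omega>. reward_upto s0 (\<lambda>s \<alpha>. \<rho> (s, \<alpha>)) G \<omega> \<partial>mdp_measure u \<tau>)"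
    by (simp add: reward_upto_eq_suminf \<rho>_nonneg H'_def)
  finally show ?thesis
    by (simp add: Exp_Reward ma_value_def mdp_value_def \<rho>)
qed

text \<open>\<open>D\<close> is the conditional law of the next action given \<open>w\<close>, that
  is \<open>choice_prob w\<close> divided by \<open>path_prob w\<close>, if \<open>w\<close> has
  positive probability.\<close>

lemma ex_conditional_choice:
  assumes w: "w \<in> mdp_paths u"
  shows "\<exists>D. set_pmf D \<subseteq> enabled (ma_prob M) (last_state s0 w) \<and>
    (\<forall>\<alpha>. choice_prob w \<alpha> =
      path_prob w * ennreal (pmf D \<alpha>))"
proof -
  let ?I = "choice_prob w"
  \<comment> \<open>Almost every run with erased prefix \<open>w\<close> has a path of the automaton
    as its prefix, and there the scheduler uses enabled actions only.\<close>
  have disabled: "?I \<alpha> = 0" if \<alpha>: "\<alpha> \<notin> enabled (ma_prob M) (last_state s0 w)" for \<alpha>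
  proof -
    have "AE \<omega> in Pr. of_bool (erased_prefix \<omega> (length w) = w) *
        ennreal (pmf (choice (prefix_path \<omega> (length w))) \<alpha>) = 0"
      using AE_label_ok
    proof eventually_elim
      case (elim \<omega>)
      let ?\<pi> = "prefix_path \<omega> (length w)"
      have "pmf (choice ?\<pi>) \<alpha> = 0" if "erased_prefix \<omega> (length w) = w"
      proof -
        have last: "last_state s0 ?\<pi> = last_state s0 w"
          by (metis last_state_erase that)
        have "?\<pi> \<in> ma_paths M"
          using elim w that by (intro prefix_path_in_ma_paths) auto
        then have "set_pmf (\<sigma> ?\<pi>) \<subseteq> enabled (ma_prob M) (last_state s0 w)"
          using scheduler unfolding ma_scheduler_def last[symmetric] by blast
        then have "set_pmf (choice ?\<pi>) \<subseteq> enabled (ma_prob M) (last_state s0 w)"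
          using enabled_MS by (auto simp: choice_def last)
        with \<alpha> show ?thesis
          by (auto simp: pmf_eq_0_set_pmf)
      qed
      then show ?case by auto
    qed
    then show ?thesis
      unfolding choice_prob_def using nn_integral_cong_AE by fastforce
  qed
  have "(\<Sum>\<alpha>\<in>UNIV. ?I \<alpha>) = (\<integral>\<^sup>+\<omega>. (\<Sum>\<alpha>\<in>UNIV. of_bool (erased_prefix \<omega> (length w) = w) *
      ennreal (pmf (choice (prefix_path \<omega> (length w))) \<alpha>)) \<partial>Pr)"
    unfolding choice_prob_def by (rule nn_integral_sum[symmetric]) (rule measurable_choice)
  also have "\<dots> = path_prob w"
    by (simp add: path_prob_def sum_distrib_left[symmetric] sum_ennreal sum_pmf_eq_1)
  finally have sum_I: "(\<Sum>\<alpha>\<in>UNIV. ?I \<alpha>) = path_prob w" .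
  \<comment> \<open>Finiteness permits passing to real numbers, in which the quotient is
    formed.\<close>
  have "path_prob w \<le> (\<integral>\<^sup>+\<omega>. 1 \<partial>Pr)"
    unfolding path_prob_def by (rule nn_integral_mono) auto
  then have fin: "path_prob w < \<top>"
    using prob_space.emeasure_space_1[OF prob_space_Pr] by (auto simp: le_less_trans)
  have I_le: "?I \<alpha> \<le> path_prob w" for \<alpha>
    unfolding sum_I[symmetric] by (rule member_le_sum) auto
  define i where "i \<alpha> = enn2real (?I \<alpha>)" for \<alpha>
  define p where "p = enn2real (path_prob w)"
  have I: "?I \<alpha> = ennreal (i \<alpha>)" for \<alpha>
    using I_le[of \<alpha>] fin by (simp add: i_def)
  have p: "path_prob w = ennreal p"
    using fin by (simp add: p_def)
  have nonneg: "0 \<le> i \<alpha>" "0 \<le> p" for \<alpha>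
    by (simp_all add: i_def p_def)
  have sum_i: "(\<Sum>\<alpha>\<in>UNIV. i \<alpha>) = p"
    using sum_I nonneg by (simp add: I p sum_ennreal sum_nonneg)
  show ?thesis
  proof (cases "p = 0")
    case True
    \<comment> \<open>For a null prefix the equation reads 0 = 0, and a point mass on any enabled
      action will do.\<close>
    obtain \<alpha> where "\<alpha> \<in> enabled (ma_prob M) (last_state s0 w)"
      using enabled_nonempty by blast
    then show ?thesis
      using I_le True p by (intro exI[of _ "return_pmf \<alpha>"]) simp
  next
    case False
    define D where "D = embed_pmf (\<lambda>\<alpha>. i \<alpha> / p)"
    have pmf_D: "pmf D \<alpha> = i \<alpha> / p" for \<alpha>
      unfolding D_def
    proof (rule pmf_embed_pmf)
      show "(\<integral>\<^sup>+\<alpha>. ennreal (i \<alpha> / p) \<partial>count_space UNIV) = 1"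
        using nonneg False sum_i
        by (simp add: nn_integral_count_space_finite sum_ennreal sum_divide_distrib[symmetric])
    qed (use nonneg in simp)
    have "set_pmf D \<subseteq> enabled (ma_prob M) (last_state s0 w)"
    proof
      fix \<alpha> assume "\<alpha> \<in> set_pmf D"
      then have "?I \<alpha> \<noteq> 0"
        by (auto simp: set_pmf_eq pmf_D i_def)
      then show "\<alpha> \<in> enabled (ma_prob M) (last_state s0 w)"
        using disabled by blast
    qed
    moreover have "?I \<alpha> = path_prob w * ennreal (pmf D \<alpha>)" for \<alpha>
      using nonneg False by (simp add: I p pmf_D ennreal_mult[symmetric])
    ultimately show ?thesis
      by blast
  qed
qed

text \<open>Histories of the MDP are discrete, so the conditional laws may be chosen independently
  for each path, with arbitrary values elsewhere.\<close>

lemma ex_mdp_scheduler: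
  "\<exists>\<tau>. mdp_scheduler u \<tau> \<and>
    distr Pr (PiM UNIV (\<lambda>_. count_space UNIV)) (\<lambda>\<omega> i. erase M (\<omega> i)) = mdp_measure u \<tau>"
proof -
  obtain \<tau> where \<tau>: "\<And>w. w \<in> mdp_paths u \<Longrightarrow> set_pmf (\<tau> w) \<subseteq> enabled (ma_prob M) (last_state s0 w) \<and>
    (\<forall>\<alpha>. choice_prob w \<alpha> =
      path_prob w * ennreal (pmf (\<tau> w) \<alpha>))"
  proof -
    have "\<forall>w\<in>mdp_paths u. \<exists>D. set_pmf D \<subseteq> enabled (ma_prob M) (last_state s0 w) \<and>
        (\<forall>\<alpha>. choice_prob w \<alpha> = path_prob w * ennreal (pmf D \<alpha>))"
      using ex_conditional_choice by blast
    from bchoice[OF this] show ?thesis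
      using that by blast
  qed
  then have "mdp_scheduler u \<tau>"
    by (simp add: mdp_scheduler_def)
  then show ?thesis
    using \<tau> distr_erase_eq_mdp_measure by blast
qed

end

section \<open>Lifting MDP schedulers to the automaton\<close>

context valid_ma
begin

lemma map_erase_in_mdp_paths: "\<pi> \<in> ma_paths M \<Longrightarrow> map (erase M) \<pi> \<in> mdp_paths u"
proof (induction \<pi> rule: rev_induct)
  case (snoc x \<pi>)
  then show ?case
    by (cases x) (auto simp: ma_paths_def mdp_paths_def is_path_snoc ma_step_def erase_def
        last_state_map split_beta)
qed (simp add: mdp_paths_def)

text \<open>Erasure maps paths to paths with the same last state, which gives enabledness.
  Measurability holds because the scheduler factors through a countable space.\<close>

lemma ma_scheduler_erase:
  assumes "mdp_scheduler u \<tau>"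
  shows "ma_scheduler M (\<lambda>\<pi>. \<tau> (map (erase M) \<pi>))"
  unfolding ma_scheduler_def
proof (intro conjI ballI allI)
  fix \<pi> assume "\<pi> \<in> ma_paths M"
  then show "set_pmf (\<tau> (map (erase M) \<pi>)) \<subseteq> enabled (ma_prob M) (last_state s0 \<pi>)"
    using assms map_erase_in_mdp_paths[of \<pi>] last_state_map[of "erase M" s0 \<pi>]
    unfolding mdp_scheduler_def by fastforce
next
  fix n \<alpha>
  show "(\<lambda>\<omega>. pmf (\<tau> (map (erase M) (prefix_path \<omega> n))) \<alpha>) \<in> borel_measurable (PiM {0..<n} (\<lambda>_. step_space))"
    by (rule measurable_compose[OF measurable_map_prefix_path[OF measurable_erase]]) simp_all
qed

text \<open>For the lifted scheduler \<open>choice\<close> is constant on the event that the erased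
  prefix is a given MDP path \<open>w\<close>, so it leaves the integral and the condition on
  conditional probabilities is immediate.\<close>

lemma distr_erase_scheduler:
  assumes \<tau>: "mdp_scheduler u \<tau>"
  shows "distr (ma_measure M (\<lambda>\<pi>. \<tau> (map (erase M) \<pi>))) (PiM UNIV (\<lambda>_. count_space UNIV)) (\<lambda>\<omega> i. erase M (\<omega> i)) =
    mdp_measure u \<tau>"
proof -
  interpret scheduled_ma M "\<lambda>\<pi>. \<tau> (map (erase M) \<pi>)"
    by unfold_locales (rule ma_scheduler_erase[OF \<tau>])
  show ?thesis
  proof (rule distr_erase_eq_mdp_measure[OF \<tau>])
    fix w \<alpha> assume w: "w \<in> mdp_paths u"
    have choice: "choice \<pi> = \<tau> w" if "map (erase M) \<pi> = w" for \<pi>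
    proof (cases "last_state s0 w \<in> PS M")
      \<comment> \<open>In a Markovian state \<open>bot_act\<close> is the only enabled action, so
        \<open>\<tau> w\<close> is the point mass that \<open>choice\<close> uses there.\<close>
      case False
      have "set_pmf (\<tau> w) \<subseteq> enabled (ma_prob M) (last_state s0 w)"
        using \<tau> w by (simp add: mdp_scheduler_def)
      then have "\<tau> w = return_pmf bot_act"
        using False by (simp add: enabled_MS set_pmf_subset_singleton)
      then show ?thesis
        using False that last_state_erase[of s0 \<pi>] by (simp add: choice_def)
    qed (use that last_state_erase[of s0 \<pi>] in \<open>simp add: choice_def\<close>)
    have "choice_prob w \<alpha> =
        (\<integral>\<^sup>+\<omega>. of_bool (erased_prefix \<omega> (length w) = w) * ennreal (pmf (\<tau> w) \<alpha>) \<partial>Pr)"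
      unfolding choice_prob_def by (rule nn_integral_cong) (auto simp: choice)
    also have "\<dots> = path_prob w * ennreal (pmf (\<tau> w) \<alpha>)"
      unfolding path_prob_def
      by (rule nn_integral_multc) (rule measurable_compose[OF measurable_erased_prefix], simp)
    finally show "choice_prob w \<alpha> =
      path_prob w * ennreal (pmf (\<tau> w) \<alpha>)" .
  qed
qed

end

section \<open>Equivalence of achievability\<close>

theorem theorem4:
  fixes M :: "('s::finite, 'a::finite) ma"
    and Os :: "'s objective list"
    and rels :: "(ereal \<Rightarrow> ereal \<Rightarrow> bool) list"
    and p :: "real list"
  assumes "markov_automaton M"
    and "action_deterministic M"
    and "deadlock_free M"
    and "maximal_progress M"
    and "non_zeno M"
    and "\<forall>Ob\<in>set Os. objective_ok (length (ma_rewards M)) Ob"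
    and "set rels \<subseteq> {(<), (\<le>), (>), (\<ge>)}"
    and "length rels = length Os"
    and "length p = length Os"
  shows "ma_achieve M Os rels p \<longleftrightarrow> mdp_achieve (underlying_mdp M) Os rels p"
proof -
  interpret valid_ma M
    by unfold_locales fact+
  \<comment> \<open>Schedulers with the same law on erased paths give every objective the same
    value, so each direction reduces to finding a partner scheduler.\<close>
  have transfer: "satisfies_all (ma_value M \<sigma>) Os rels p \<longleftrightarrow> satisfies_all (mdp_value u \<tau>) Os rels p"
    if "ma_scheduler M \<sigma>"
      and "distr (ma_measure M \<sigma>) (PiM UNIV (\<lambda>_. count_space UNIV)) (\<lambda>\<omega> i. erase M (\<omega> i)) = mdp_measure u \<tau>"
    for \<sigma> \<tau>
  proof -
    interpret scheduled_ma M \<sigma>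
      by unfold_locales fact
    show ?thesis
      using value_eq[OF that(2)] assms(6) by (simp add: satisfies_all_def)
  qed
  show ?thesis
  proof
    assume "ma_achieve M Os rels p"
    then obtain \<sigma> where \<sigma>: "ma_scheduler M \<sigma>" "satisfies_all (ma_value M \<sigma>) Os rels p"
      by (auto simp: ma_achieve_def)
    interpret scheduled_ma M \<sigma>
      by unfold_locales fact
    show "mdp_achieve u Os rels p"
      using ex_mdp_scheduler transfer[OF \<sigma>(1)] \<sigma>(2) by (auto simp: mdp_achieve_def)
  next
    assume "mdp_achieve u Os rels p"
    then obtain \<tau> where \<tau>: "mdp_scheduler u \<tau>" "satisfies_all (mdp_value u \<tau>) Os rels p"
      by (auto simp: mdp_achieve_def)
    show "ma_achieve M Os rels p"
      using transfer[OF ma_scheduler_erase[OF \<tau>(1)] distr_erase_scheduler[OF \<tau>(1)]]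
        ma_scheduler_erase[OF \<tau>(1)] \<tau>(2)
      by (auto simp: ma_achieve_def)
  qed
qed

end
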